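(* For every choice function $\theta$ and every $\theta$-NMDA $\mathcal{A}$, there exists a $\theta$-DMDA $\mathcal{D}$ equivalent to $\mathcal{A}$ (with respect to finite words and with respect to infinite words), of size in $2^{O(|\mathcal{A}|)}$, and such that every state of $\mathcal{D}$ can be represented in space polynomial in $|\mathcal{A}|$.
   Context: An alphabet $\Sigma$ is a finite nonempty set; $\Sigma^+$ denotes nonempty finite words. An NMDA is a tuple $\mathcal{A}=\langle \Sigma,Q,\iota,\delta,\gamma,\rho\rangle$ with finite state set $Q$, initial states $\iota\subseteq Q$, transition relation $\delta\subseteq Q\times\Sigma\times Q$, weight function $\gamma:\delta\to\mathbb{Q}$ and discount-factor function $\rho:\delta\to\mathbb{Q}\cap(1,\infty)$; NMDAs are assumed complete (every state has at least one outgoing transition on every letter). A run on a finite or infinite word $w=\sigma_0\sigma_1\cdots$ is $p_0,\sigma_0,p_1,\ldots$ with $p_0\in\iota$ and $t_i=(p_i,\sigma_i,p_{i+1})\in\delta$; its value is $\sum_{i}\gamma(t_i)\prod_{j<i}\frac{1}{\rho(t_j)}$, and $\mathcal{A}(w)$ is the infimum of values of runs on $w$. A DMDA is an NMDA with $|\iota|=1$ and at most one successor per state and letter. An NMDA is integral if all discount factors are integers. Two automata are equivalent if they assign the same value to every word. The size $|\mathcal{A}|$ is the maximum of the number of transitions and the maximal length of the binary representation of any weight or discount factor in $\mathcal{A}$; all weights are assumed to be written with a common denominator. An integral NMDA $\mathcal{A}$ is a $\theta$-NMDA, for a function $\theta:\Sigma^+\to\mathbb{N}\setminus\{0,1\}$,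 if for every $u=\sigma_1\cdots\sigma_n\in\Sigma^+$ and every run $q_0,\sigma_1,q_1,\ldots,\sigma_n,q_n$ of $\mathcal{A}$ on $u$ we have $\rho(q_{n-1},\sigma_n,q_n)=\theta(u)$; a $\theta$-DMDA is a deterministic $\theta$-NMDA. A function $\theta:\Sigma^+\to\mathbb{N}\setminus\{0,1\}$ is a choice function if some integral NMDA is a $\theta$-NMDA.
   Formalization: The constant in the size bound 2^{O(|A|)} may depend on the alphabet (not on the choice function or on A), since a constant uniform over all alphabets is impossible for this notion of size; automata are required to have at least one initial state. *)

theory Defs
  imports Complex_Main "HOL-Library.Log_Nat" "HOL-Computational_Algebra.Polynomial"
begin

record ('a, 's) nmda =
  alphabet :: "'a set"
  states :: "'s set"
  initials :: "'s set"
  transitions :: "('s \<times> 'a \<times> 's) set"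
  weight :: "'s \<times> 'a \<times> 's \<Rightarrow> rat"
  discount :: "'s \<times> 'a \<times> 's \<Rightarrow> rat"

text \<open>Completeness is part of the definition. There must be at least one initial state:
  otherwise there are no runs, and the infimum defining the value of a word is over the empty set.\<close>

definition is_NMDA :: "('a, 's) nmda \<Rightarrow> bool" where
  "is_NMDA A \<longleftrightarrow>
     finite (alphabet A) \<and> alphabet A \<noteq> {} \<and>
     finite (states A) \<and>
     initials A \<subseteq> states A \<and> initials A \<noteq> {} \<and>
     transitions A \<subseteq> states A \<times> alphabet A \<times> states A \<and>
     (\<forall>t \<in> transitions A. discount A t > 1) \<and>
     (\<forall>q \<in> states A. \<forall>a \<in> alphabet A. \<exists>q'. (q, a, q') \<in> transitions A)"

definition is_DMDA :: "('a, 's) nmda \<Rightarrow> bool" where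
  "is_DMDA A \<longleftrightarrow>
     is_NMDA A \<and> card (initials A) = 1 \<and>
     (\<forall>q a p p'. (q, a, p) \<in> transitions A \<and> (q, a, p') \<in> transitions A \<longrightarrow> p = p')"

definition integral_NMDA :: "('a, 's) nmda \<Rightarrow> bool" where
  "integral_NMDA A \<longleftrightarrow> is_NMDA A \<and> (\<forall>t \<in> transitions A. discount A t \<in> \<int>)"

subsection \<open>Runs and values\<close>

definition step :: "(nat \<Rightarrow> 's) \<Rightarrow> (nat \<Rightarrow> 'a) \<Rightarrow> nat \<Rightarrow> 's \<times> 'a \<times> 's" where
  "step r w i = (r i, w i, r (Suc i))"

definition fin_run :: "('a, 's) nmda \<Rightarrow> 'a list \<Rightarrow> 's list \<Rightarrow> bool" where
  "fin_run A w ps \<longleftrightarrow>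
     length ps = Suc (length w) \<and> ps ! 0 \<in> initials A \<and>
     (\<forall>i < length w. step ((!) ps) ((!) w) i \<in> transitions A)"

definition inf_run :: "('a, 's) nmda \<Rightarrow> (nat \<Rightarrow> 'a) \<Rightarrow> (nat \<Rightarrow> 's) \<Rightarrow> bool" where
  "inf_run A w r \<longleftrightarrow> r 0 \<in> initials A \<and> (\<forall>i. step r w i \<in> transitions A)"

definition discounted_weight ::
    "('a, 's) nmda \<Rightarrow> (nat \<Rightarrow> 's) \<Rightarrow> (nat \<Rightarrow> 'a) \<Rightarrow> nat \<Rightarrow> real" where
  "discounted_weight A r w i =
     of_rat (weight A (step r w i)) * (\<Prod>j<i. 1 / of_rat (discount A (step r w j)))"

definition fin_run_value :: "('a, 's) nmda \<Rightarrow> 'a list \<Rightarrow> 's list \<Rightarrow> real" where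
  "fin_run_value A w ps = (\<Sum>i<length w. discounted_weight A ((!) ps) ((!) w) i)"

definition inf_run_value :: "('a, 's) nmda \<Rightarrow> (nat \<Rightarrow> 'a) \<Rightarrow> (nat \<Rightarrow> 's) \<Rightarrow> real" where
  "inf_run_value A w r = (\<Sum>i. discounted_weight A r w i)"

text \<open>For an NMDA and a word over its alphabet, the sets below are nonempty and bounded, and the
  series converges absolutely, as there are finitely many transitions and all discount factors
  exceed 1. So the infimum over the reals is the intended one.\<close>

definition fin_value :: "('a, 's) nmda \<Rightarrow> 'a list \<Rightarrow> real" where
  "fin_value A w = Inf {fin_run_value A w ps | ps. fin_run A w ps}"

definition inf_value :: "('a, 's) nmda \<Rightarrow> (nat \<Rightarrow> 'a) \<Rightarrow> real" where
  "inf_value A w = Inf {inf_run_value A w r | r. inf_run A w r}"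

definition equivalent_fin :: "('a, 's) nmda \<Rightarrow> ('a, 't) nmda \<Rightarrow> bool" where
  "equivalent_fin A B \<longleftrightarrow>
     alphabet A = alphabet B \<and> (\<forall>w \<in> lists (alphabet A). fin_value A w = fin_value B w)"

definition equivalent_inf :: "('a, 's) nmda \<Rightarrow> ('a, 't) nmda \<Rightarrow> bool" where
  "equivalent_inf A B \<longleftrightarrow>
     alphabet A = alphabet B \<and>
     (\<forall>w. range w \<subseteq> alphabet A \<longrightarrow> inf_value A w = inf_value B w)"

subsection \<open>Size\<close>

text \<open>An integer is written with a sign bit, a fraction as a pair of integers. The weights are
  written with their least common denominator, discount factors in lowest terms.\<close>

definition int_length :: "int \<Rightarrow> nat" where
  "int_length z = 1 + floorlog 2 (nat \<bar>z\<bar>)"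

definition common_denominator :: "('a, 's) nmda \<Rightarrow> int" where
  "common_denominator A = Lcm ((\<lambda>t. snd (quotient_of (weight A t))) ` transitions A)"

definition weight_length :: "('a, 's) nmda \<Rightarrow> 's \<times> 'a \<times> 's \<Rightarrow> nat" where
  "weight_length A t =
     int_length \<lfloor>weight A t * of_int (common_denominator A)\<rfloor> + int_length (common_denominator A)"

definition discount_length :: "('a, 's) nmda \<Rightarrow> 's \<times> 'a \<times> 's \<Rightarrow> nat" where
  "discount_length A t =
     int_length (fst (quotient_of (discount A t))) + int_length (snd (quotient_of (discount A t)))"

definition nmda_size :: "('a, 's) nmda \<Rightarrow> nat" where
  "nmda_size A =
     Max ({card (transitions A)} \<union> weight_length A ` transitions A
          \<union> discount_length A ` transitions A)"

subsection \<open>Choice functions\<close>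

text \<open>A function on the nonempty words over \<open>S\<close> is represented by a total function on lists; its
  values on other lists are irrelevant.\<close>

definition discount_choice :: "'a set \<Rightarrow> ('a list \<Rightarrow> nat) \<Rightarrow> bool" where
  "discount_choice S \<theta> \<longleftrightarrow> (\<forall>u \<in> lists S. u \<noteq> [] \<longrightarrow> \<theta> u \<notin> {0, 1})"

definition theta_NMDA :: "'a set \<Rightarrow> ('a list \<Rightarrow> nat) \<Rightarrow> ('a, 's) nmda \<Rightarrow> bool" where
  "theta_NMDA S \<theta> A \<longleftrightarrow>
     alphabet A = S \<and> discount_choice S \<theta> \<and> integral_NMDA A \<and>
     (\<forall>u \<in> lists S. \<forall>ps. u \<noteq> [] \<and> fin_run A u ps \<longrightarrow>
        discount A (step ((!) ps) ((!) u) (length u - 1)) = of_nat (\<theta> u))"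

definition theta_DMDA :: "'a set \<Rightarrow> ('a list \<Rightarrow> nat) \<Rightarrow> ('a, 's) nmda \<Rightarrow> bool" where
  "theta_DMDA S \<theta> A \<longleftrightarrow> theta_NMDA S \<theta> A \<and> is_DMDA A"

text \<open>State sets are finite, so letting the states of the witness be natural numbers is no
  restriction.\<close>

definition choice_function :: "'a set \<Rightarrow> ('a list \<Rightarrow> nat) \<Rightarrow> bool" where
  "choice_function S \<theta> \<longleftrightarrow>
     discount_choice S \<theta> \<and> (\<exists>A :: ('a, nat) nmda. theta_NMDA S \<theta> A)"

text \<open>Every state is represented by its own bit string of length at most \<open>b\<close>.\<close>

definition states_representable :: "('a, 's) nmda \<Rightarrow> nat \<Rightarrow> bool" where
  "states_representable A b \<longleftrightarrow>
     (\<exists>enc :: 's \<Rightarrow> bool list. inj_on enc (states A) \<and> (\<forall>q \<in> states A. length (enc q) \<le> b))"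

end

theory Submission
  imports Defs "HOL-Library.FuncSet" "HOL-Library.Multiset"
begin

text \<open>
  The states of \<open>D\<close> are the residuals of words: the residual of \<open>u\<close> records, for every continuation \<open>v\<close>,
  the product of the discount factors along \<open>v\<close> and the cost of \<open>v\<close> after \<open>u\<close>, rescaled by the
  product of the discount factors along \<open>u\<close>. Since all discount factors are at least 2, values on
  infinite words are limits of values on prefixes, so only finite words matter.

  A residual is determined by the vector of gaps: the gap of a state is the rescaled extra cost of the best run
  ending there, and gaps beyond a threshold \<open>T = 2 ^ O(n)\<close> are irrelevant, where \<open>n\<close> is the size
  of \<open>A\<close>. Counting all vectors of gaps below \<open>T\<close> would only bound the number of states by
  \<open>2 ^ O(n\<^sup>2)\<close>. Instead, read the last \<open>m = O(n)\<close> letters \<open>v\<close> of a word separately, with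
  \<open>2 ^ m \<ge> T\<close>. A gap after \<open>v\<close> has the form \<open>M(q, p) + r x(p) - N\<close>, where \<open>p\<close> is an optimal state
  before \<open>v\<close>, the number \<open>x(p)\<close> is an integer, and \<open>M\<close> depends only on \<open>v\<close>; as \<open>r \<ge> 2 ^ m \<ge> T\<close>, it is
  determined by its residue modulo \<open>r\<close>, hence by \<open>v\<close>, by a state attaining the minimum and by the choice
  \<open>q \<mapsto> p\<close> of optimal states. There are too many such choices as well, but two choices with
  fibres of the same sizes are interchangeable, by the argument that bounds the number of cells of an arrangement
  of tropical hyperplanes, and there are only \<open>2 ^ O(n)\<close> vectors of fibre sizes.
\<close>

subsection \<open>Infinite words as limits of their prefixes\<close>

text \<open>An integer above 1 is at least 2. This yields the ratio 1/2 for tails of runs and the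
  growth \<open>2 ^ length u\<close> of discount products.\<close>

lemma discount_ge_2:
  assumes "integral_NMDA A" "t \<in> transitions A"
  shows "discount A t \<ge> 2"
proof -
  obtain k where k: "discount A t = of_int k" using assms by (auto simp: integral_NMDA_def elim: Ints_cases)
  have "discount A t > 1" using assms by (auto simp: integral_NMDA_def is_NMDA_def)
  then have "of_int k > (of_int 1 :: rat)" using k by simp
  then have "k \<ge> 2" by (simp only: of_int_less_iff)
  then have "of_int k \<ge> (of_int 2 :: rat)" by (simp only: of_int_le_iff)
  then show ?thesis using k by simp
qed

section \<open>Finite runs and their values\<close>

lemma finite_transitions: "is_NMDA A \<Longrightarrow> finite (transitions A)"
  unfolding is_NMDA_def by (meson finite_SigmaI finite_subset)

lemma successor_exists:
  assumes "is_NMDA A" "q \<in> states A" "a \<in> alphabet A"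
  obtains q' where "(q, a, q') \<in> transitions A" "q' \<in> states A"
  using assms unfolding is_NMDA_def by blast

lemma fin_run_in_states:
  assumes "is_NMDA A" "fin_run A w ps" "i \<le> length w"
  shows "ps ! i \<in> states A"
proof (cases i)
  case 0
  then show ?thesis using assms by (auto simp: is_NMDA_def fin_run_def)
next
  case (Suc j)
  then have "step ((!) ps) ((!) w) j \<in> transitions A" using assms by (auto simp: fin_run_def)
  then show ?thesis using assms(1) Suc by (auto simp: is_NMDA_def step_def)
qed

lemma fin_run_Nil: "fin_run A [] ps \<longleftrightarrow> (\<exists>p\<in>initials A. ps = [p])"
  by (auto simp: fin_run_def length_Suc_conv)

lemma last_eq_nth: "length xs = Suc n \<Longrightarrow> last xs = xs ! n"
  by (metis diff_Suc_1 last_conv_nth list.size(3) nat.distinct(1))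

lemma fin_run_snoc:
  "fin_run A (w @ [a]) (ps @ [q]) \<longleftrightarrow> fin_run A w ps \<and> (last ps, a, q) \<in> transitions A"
proof (cases "length ps = Suc (length w)")
  case True
  have 1: "step ((!) (ps @ [q])) ((!) (w @ [a])) i = step ((!) ps) ((!) w) i" if "i < length w" for i
    using that True by (simp add: step_def nth_append)
  have "last ps = ps ! length w" using True by (rule last_eq_nth)
  then have 2: "step ((!) (ps @ [q])) ((!) (w @ [a])) (length w) = (last ps, a, q)"
    using True by (simp add: step_def nth_append)
  have 3: "(ps @ [q]) ! 0 = ps ! 0" using True by (simp add: nth_append)
  have "(\<forall>i<length (w @ [a]). step ((!) (ps @ [q])) ((!) (w @ [a])) i \<in> transitions A) \<longleftrightarrow>
      (\<forall>i<length w. step ((!) ps) ((!) w) i \<in> transitions A) \<and> (last ps, a, q) \<in> transitions A"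
    unfolding length_append_singleton All_less_Suc 2 using 1 by (metis (no_types))
  then show ?thesis unfolding fin_run_def 3 using True by simp
qed (auto simp: fin_run_def)

lemma fin_run_snocE:
  assumes "fin_run A (w @ [a]) ps"
  obtains ps' q where "ps = ps' @ [q]" "fin_run A w ps'" "(last ps', a, q) \<in> transitions A"
proof -
  have "ps \<noteq> []" using assms by (auto simp: fin_run_def)
  then obtain ps' q where "ps = ps' @ [q]" by (metis append_butlast_last_id)
  with assms that show thesis by (auto simp: fin_run_snoc)
qed

lemma discounted_weight_cong:
  assumes "\<And>j. j \<le> Suc i \<Longrightarrow> r j = r' j" "\<And>j. j \<le> i \<Longrightarrow> w j = w' j"
  shows "discounted_weight A r w i = discounted_weight A r' w' i"
  using assms by (auto simp: discounted_weight_def step_def)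

lemma fin_run_value_snoc:
  assumes "length ps = Suc (length w)"
  shows "fin_run_value A (w @ [a]) (ps @ [q]) =
    fin_run_value A w ps +
      of_rat (weight A (last ps, a, q)) *
        (\<Prod>j<length w. 1 / of_rat (discount A (step ((!) ps) ((!) w) j)))"
proof -
  have 1: "step ((!) (ps @ [q])) ((!) (w @ [a])) i = step ((!) ps) ((!) w) i" if "i < length w" for i
    using that assms by (simp add: step_def nth_append)
  have 2: "step ((!) (ps @ [q])) ((!) (w @ [a])) (length w) = (last ps, a, q)"
    using assms last_eq_nth[OF assms] by (simp add: step_def nth_append)
  have "discounted_weight A ((!) (ps @ [q])) ((!) (w @ [a])) i = discounted_weight A ((!) ps) ((!) w) i"
    if "i < length w" for i
    using that 1 by (simp add: discounted_weight_def)
  then show ?thesis using 1 2 by (simp add: fin_run_value_def discounted_weight_def[of _ _ _ "length w"])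
qed

lemma ex_fin_run:
  assumes "is_NMDA A" "w \<in> lists (alphabet A)"
  shows "\<exists>ps. fin_run A w ps"
  using assms(2)
proof (induction w rule: rev_induct)
  case Nil
  then show ?case using assms(1) by (auto simp: is_NMDA_def fin_run_Nil)
next
  case (snoc a w)
  then obtain ps where ps: "fin_run A w ps" by auto
  then have "last ps \<in> states A" using fin_run_in_states[OF assms(1) ps, of "length w"]
    using ps last_eq_nth[of ps "length w"] by (simp add: fin_run_def)
  then show ?case using successor_exists[OF assms(1)] snoc.prems ps
    by (metis Cons_in_lists_iff append_in_lists_conv fin_run_snoc)
qed

lemma fin_value_eqI:
  assumes "fin_run A w ps" "\<And>ps'. fin_run A w ps' \<Longrightarrow> fin_run_value A w ps \<le> fin_run_value A w ps'"
  shows "fin_value A w = fin_run_value A w ps"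
  unfolding fin_value_def by (rule cInf_eq_minimum) (use assms in auto)

text \<open>Every infinite run restricts to a run on each prefix, and by completeness every run on a
  prefix extends to an infinite run. The two values differ by at most
  \<open>2 * K * (1/2)^i\<close>, hence so do the infima.\<close>

lemma inf_value_limit:
  fixes w :: "nat \<Rightarrow> 'a"
  assumes A: "integral_NMDA A" and w: "range w \<subseteq> alphabet A"
  shows "(\<lambda>i. fin_value A (map w [0..<i])) \<longlonglongrightarrow> inf_value A w"
proof -
  have N: "is_NMDA A" using A by (simp add: integral_NMDA_def)
  define K where "K = (\<Sum>t\<in>transitions A. \<bar>of_rat (weight A t)\<bar> :: real)"
  have K: "\<bar>of_rat (weight A t)\<bar> \<le> K" if "t \<in> transitions A" for t
    unfolding K_def using that finite_transitions[OF N] by (intro member_le_sum) auto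
  have K0: "K \<ge> 0" unfolding K_def by (intro sum_nonneg) auto
  have dw: "\<bar>discounted_weight A r w' i\<bar> \<le> K * (1/2)^i"
    if "\<And>j. j \<le> i \<Longrightarrow> step r w' j \<in> transitions A" for r w' i
  proof -
    have "\<bar>1 / of_rat (discount A (step r w' j)) :: real\<bar> \<le> 1/2" if "j < i" for j
    proof -
      have "discount A (step r w' j) \<ge> 2" using discount_ge_2[OF A] \<open>\<And>j. j \<le> i \<Longrightarrow> _\<close> that by simp
      then have "of_rat (discount A (step r w' j)) \<ge> (of_rat 2 :: real)" by (simp only: of_rat_less_eq)
      then have 2: "of_rat (discount A (step r w' j)) \<ge> (2 :: real)" by simp
      have "\<bar>1 / x\<bar> \<le> 1 / 2" if "2 \<le> x" for x :: real
        using that by (simp add: field_simps)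
      from this[OF 2] show ?thesis .
    qed
    then have "(\<Prod>j<i. \<bar>1 / of_rat (discount A (step r w' j)) :: real\<bar>) \<le> (\<Prod>j<i. 1/2)"
      by (intro prod_mono) auto
    then show ?thesis unfolding discounted_weight_def abs_mult abs_prod
      using K[OF that[of i]] K0 by (intro mult_mono) (auto intro!: prod_nonneg)
  qed
  have geo: "summable (\<lambda>j. K * (1/2)^j :: real)" by (intro summable_mult summable_geometric) auto
  have tail: "\<bar>inf_run_value A w r - fin_run_value A (map w [0..<i]) (map r [0..<Suc i])\<bar> \<le> 2 * K * (1/2)^i"
    if r: "inf_run A w r" for r i
    \<comment> \<open>the tail is dominated by a geometric series, as all discount factors are at least 2\<close>
  proof -
    let ?f = "discounted_weight A r w"
    have bd: "\<bar>?f j\<bar> \<le> K * (1/2)^j" for j using r by (intro dw) (auto simp: inf_run_def)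
    have sm: "summable ?f" by (rule summable_comparison_test[OF _ geo]) (use bd in auto)
    have "fin_run_value A (map w [0..<i]) (map r [0..<Suc i]) = sum ?f {..<i}"
      unfolding fin_run_value_def
      by (rule sum.cong) (auto intro!: discounted_weight_cong simp del: upt_Suc)
    then have eq: "inf_run_value A w r - fin_run_value A (map w [0..<i]) (map r [0..<Suc i]) = (\<Sum>j. ?f (j + i))"
      unfolding inf_run_value_def using suminf_split_initial_segment[OF sm, of i] by simp
    have geo': "summable (\<lambda>j. K * (1/2)^(j + i) :: real)"
      using summable_ignore_initial_segment[OF geo] by simp
    have sa: "summable (\<lambda>j. \<bar>?f (j + i)\<bar>)"
      by (rule summable_comparison_test[OF _ geo']) (use bd in auto)
    have "\<bar>\<Sum>j. ?f (j + i)\<bar> \<le> (\<Sum>j. \<bar>?f (j + i)\<bar>)" by (rule summable_rabs[OF sa])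
    also have "\<dots> \<le> (\<Sum>j. K * (1/2)^(j + i))" by (rule suminf_le[OF _ sa geo']) (use bd in auto)
    also have "\<dots> = (\<Sum>j. (K * (1/2)^i) * (1/2)^j)" by (simp only: power_add mult_ac)
    also have "\<dots> = (K * (1/2)^i) * 2"
      using suminf_mult[OF summable_geometric, of "1/2 :: real" "K * (1/2)^i"] by (simp add: suminf_geometric)
    finally show ?thesis using eq by simp
  qed
  have prefix: "fin_run A (map w [0..<i]) (map r [0..<Suc i])" if "inf_run A w r" for r i
    using that by (auto simp: fin_run_def inf_run_def step_def simp del: upt_Suc)
  have extend: "\<exists>r. inf_run A w r \<and> map r [0..<Suc i] = ps" if ps: "fin_run A (map w [0..<i]) ps" for ps i
  proof -
    define nxt where "nxt q a = (SOME q'. (q, a, q') \<in> transitions A)" for q a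
    have nxt: "(q, a, nxt q a) \<in> transitions A" "nxt q a \<in> states A" if "q \<in> states A" "a \<in> alphabet A" for q a
    proof -
      show "(q, a, nxt q a) \<in> transitions A"
        unfolding nxt_def using successor_exists[OF N that] by (metis someI)
      then show "nxt q a \<in> states A" using N by (auto simp: is_NMDA_def)
    qed
    \<comment> \<open>Past the last state of \<open>ps\<close>, successors chosen by completeness
      are followed; \<open>s j\<close> is the state after \<open>i + j\<close> letters.\<close>
    define s where "s = rec_nat (ps ! i) (\<lambda>j q. nxt q (w (i + j)))"
    define r where "r j = (if j \<le> i then ps ! j else s (j - i))" for j
    have s0: "s 0 = ps ! i" and sS: "s (Suc j) = nxt (s j) (w (i + j))" for j by (auto simp: s_def)
    have wi: "w j \<in> alphabet A" for j using w by auto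
    have ss: "s j \<in> states A" for j
      by (induction j) (use fin_run_in_states[OF N ps, of i] nxt wi s0 sS in auto)
    have len: "length ps = Suc i" using ps by (simp add: fin_run_def)
    have "step r w j \<in> transitions A" for j
    proof (cases "j < i")
      case True
      then have "step ((!) ps) ((!) (map w [0..<i])) j \<in> transitions A" using ps by (simp add: fin_run_def)
      then show ?thesis using True by (simp add: step_def r_def)
    next
      case False
      then have "r j = s (j - i)" "r (Suc j) = s (Suc (j - i))" using s0 by (auto simp: r_def Suc_diff_le)
      then show ?thesis using False nxt(1)[OF ss wi] by (simp add: step_def sS)
    qed
    moreover have "r 0 \<in> initials A" using ps by (simp add: r_def fin_run_def)
    moreover have "map r [0..<Suc i] = ps"
      by (rule nth_equalityI) (use len in \<open>auto simp: r_def simp del: upt_Suc\<close>)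
    ultimately show ?thesis by (auto simp: inf_run_def)
  qed
  have pre: "map w [0..<i] \<in> lists (alphabet A)" for i using w by (auto simp: range_subsetD)
  have ne: "\<exists>ps. fin_run A (map w [0..<i]) ps" for i using ex_fin_run[OF N pre] .
  obtain r0 where r0: "inf_run A w r0" using extend[of 0] ne[of 0] by auto
  \<comment> \<open>\<open>Inf\<close> over the reals needs sets bounded below. The estimate
    \<open>tail\<close> at \<open>i = 0\<close>, where the finite value is 0, bounds the infinite
    runs; a further use of \<open>tail\<close> bounds the finite ones.\<close>
  have runlow: "inf_run_value A w r \<ge> - 2 * K" if "inf_run A w r" for r
    using tail[OF that, of 0] by (simp add: fin_run_value_def)
  have bddi: "bdd_below {inf_run_value A w r | r. inf_run A w r}"
    by (rule bdd_belowI[of _ "- 2 * K"]) (use runlow in blast)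
  have finlow: "fin_run_value A (map w [0..<i]) ps \<ge> - 4 * K" if f: "fin_run A (map w [0..<i]) ps" for ps i
  proof -
    obtain r where r: "inf_run A w r" "map r [0..<Suc i] = ps" using extend[OF f] by auto
    have "(1/2)^i \<le> (1::real)" by (simp add: power_le_one)
    then have "2 * K * (1/2)^i \<le> 2 * K" using K0 by (simp add: mult_left_le)
    then show ?thesis using runlow[OF r(1)] tail[OF r(1), of i, unfolded r(2)] by linarith
  qed
  have bddf: "bdd_below {fin_run_value A (map w [0..<i]) ps | ps. fin_run A (map w [0..<i]) ps}" for i
    by (rule bdd_belowI[of _ "- 4 * K"]) (use finlow in blast)
  have close: "\<bar>fin_value A (map w [0..<i]) - inf_value A w\<bar> \<le> 2 * K * (1/2)^i" for i
  proof -
    have "fin_value A (map w [0..<i]) - 2 * K * (1/2)^i \<le> inf_value A w"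
      unfolding inf_value_def
    proof (rule cInf_greatest)
      fix x assume "x \<in> {inf_run_value A w r | r. inf_run A w r}"
      then obtain r where r: "x = inf_run_value A w r" "inf_run A w r" by auto
      have "fin_value A (map w [0..<i]) \<le> fin_run_value A (map w [0..<i]) (map r [0..<Suc i])"
        unfolding fin_value_def by (rule cInf_lower[OF _ bddf]) (use prefix[OF r(2)] in blast)
      then show "fin_value A (map w [0..<i]) - 2 * K * (1/2)^i \<le> x" using tail[OF r(2), of i] r(1) by linarith
    qed (use r0 in auto)
    moreover have "inf_value A w - 2 * K * (1/2)^i \<le> fin_value A (map w [0..<i])"
      unfolding fin_value_def
    proof (rule cInf_greatest)
      fix x assume "x \<in> {fin_run_value A (map w [0..<i]) ps | ps. fin_run A (map w [0..<i]) ps}"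
      then obtain ps where ps: "x = fin_run_value A (map w [0..<i]) ps" "fin_run A (map w [0..<i]) ps" by auto
      obtain r where r: "inf_run A w r" "map r [0..<Suc i] = ps" using extend[OF ps(2)] by auto
      have "inf_value A w \<le> inf_run_value A w r"
        unfolding inf_value_def by (rule cInf_lower[OF _ bddi]) (use r in blast)
      then show "inf_value A w - 2 * K * (1/2)^i \<le> x" using tail[OF r(1), of i, unfolded r(2)] ps(1) by linarith
    qed (use ne in auto)
    ultimately show ?thesis by linarith
  qed
  have "(\<lambda>i. 2 * K * (1/2)^i :: real) \<longlonglongrightarrow> 0"
    by (rule tendsto_mult_right_zero, rule LIMSEQ_realpow_zero) auto
  then have "(\<lambda>i. fin_value A (map w [0..<i]) - inf_value A w) \<longlonglongrightarrow> 0"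
    by (rule tendsto_0_le[where K = 1]) (use close K0 in \<open>auto simp: abs_mult\<close>)
  then show ?thesis by (simp add: LIM_zero_iff)
qed

text \<open>Both values of an infinite word are limits of the same sequence of values on
  prefixes.\<close>

lemma equivalent_inf_if_equivalent_fin:
  fixes A :: "('a, 's) nmda" and B :: "('a, 't) nmda"
  assumes "integral_NMDA A" "integral_NMDA B" "equivalent_fin A B"
  shows "equivalent_inf A B"
  unfolding equivalent_inf_def
proof (intro conjI allI impI)
  show ab: "alphabet A = alphabet B" using assms by (simp add: equivalent_fin_def)
  fix w :: "nat \<Rightarrow> 'a" assume w: "range w \<subseteq> alphabet A"
  have "map w [0..<i] \<in> lists (alphabet A)" for i using w by (auto simp: range_subsetD)
  then have "fin_value A (map w [0..<i]) = fin_value B (map w [0..<i])" for i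
    using assms(3) by (simp add: equivalent_fin_def)
  then have "(\<lambda>i. fin_value A (map w [0..<i])) \<longlonglongrightarrow> inf_value B w"
    using inf_value_limit[OF assms(2), of w] w ab by simp
  then show "inf_value A w = inf_value B w"
    by (rule LIMSEQ_unique[OF inf_value_limit[OF assms(1) w]])
qed

subsection \<open>The residual automaton\<close>

text \<open>For \<open>u\<close> over the alphabet, this is the product of the discount factors
  along every run of a \<open>\<theta>\<close>-NMDA on \<open>u\<close>, as
  \<open>run_of_path\<close> shows.\<close>

definition discount_product :: "('a list \<Rightarrow> nat) \<Rightarrow> 'a list \<Rightarrow> nat" where
  "discount_product \<theta> u = (\<Prod>i<length u. \<theta> (take (Suc i) u))"

lemma discount_product_Nil [simp]: "discount_product \<theta> [] = 1"
  by (simp add: discount_product_def)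

lemma discount_product_snoc [simp]:
  "discount_product \<theta> (u @ [a]) = discount_product \<theta> u * \<theta> (u @ [a])"
  by (simp add: discount_product_def)

lemma discount_choice_gt_1:
  assumes "discount_choice S \<theta>" "u \<in> lists S" "u \<noteq> []"
  shows "\<theta> u > 1"
proof -
  have "\<theta> u \<notin> {0, 1}" using assms unfolding discount_choice_def by blast
  then show ?thesis by auto
qed

lemma discount_product_pos:
  assumes "discount_choice S \<theta>" "u \<in> lists S"
  shows "discount_product \<theta> u > 0"
  using assms(2)
proof (induction u rule: rev_induct)
  case (snoc a u)
  then have "\<theta> (u @ [a]) > 1" by (intro discount_choice_gt_1[OF assms(1)]) auto
  with snoc show ?case by simp
qed simp

text \<open>Restriction to \<open>lists S\<close> turns equality of residuals into plain equality of
  functions. The first component makes a residual determine discount factors as well as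
  weights.\<close>

definition residual ::
    "'a set \<Rightarrow> ('a list \<Rightarrow> nat) \<Rightarrow> ('a list \<Rightarrow> rat) \<Rightarrow> 'a list \<Rightarrow> 'a list \<Rightarrow> rat \<times> rat" where
  "residual S \<theta> f u = restrict (\<lambda>v.
     (of_nat (discount_product \<theta> (u @ v)) / of_nat (discount_product \<theta> u),
      of_nat (discount_product \<theta> u) * (f (u @ v) - f u))) (lists S)"

text \<open>A Myhill-Nerode construction: the residual of \<open>u\<close> determines the weight and
  the discount factor of the next letter \<open>a\<close> and the residual of
  \<open>u @ [a]\<close>. The weights are rescaled increments of \<open>f\<close>, so they telescope
  along the unique run.\<close>

lemma residual_automaton:
  fixes S :: "'a set" and f :: "'a list \<Rightarrow> rat"
  assumes S: "finite S" "S \<noteq> {}" and \<theta>: "discount_choice S \<theta>" and f0: "f [] = 0"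
    and fin: "finite (residual S \<theta> f ` lists S)"
  obtains D :: "('a, nat) nmda"
  where "theta_DMDA S \<theta> D"
    and "\<And>w. w \<in> lists S \<Longrightarrow> fin_value D w = of_rat (f w)"
    and "card (states D) = card (residual S \<theta> f ` lists S)"
    and "card (transitions D) = card (states D) * card S"
    and "\<And>t. t \<in> transitions D \<Longrightarrow> \<exists>u\<in>lists S. \<exists>a\<in>S.
           weight D t = of_nat (discount_product \<theta> u) * (f (u @ [a]) - f u) \<and>
           discount D t = of_nat (\<theta> (u @ [a]))"
proof -
  let ?R = "residual S \<theta> f" and ?p = "discount_product \<theta>"
  \<comment> \<open>States must be natural numbers, so the finitely many residuals are numbered by
    \<open>g\<close>.\<close>
  obtain g :: "('a list \<Rightarrow> rat \<times> rat) \<Rightarrow> nat" where g: "inj_on g (?R ` lists S)"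
    using finite_imp_inj_to_nat_seg[OF fin] by auto
  define st where "st u = g (?R u)" for u
  have st_eq: "st u = st v \<longleftrightarrow> ?R u = ?R v" if "u \<in> lists S" "v \<in> lists S" for u v
    using g that by (auto simp: st_def dest: inj_onD)
  have ppos: "?p u > 0" if "u \<in> lists S" for u using discount_product_pos[OF \<theta> that] .
  have theta2: "\<theta> (u @ [a]) > 1" if "u \<in> lists S" "a \<in> S" for u a
    using that by (intro discount_choice_gt_1[OF \<theta>]) auto
  have th: "of_nat (?p (u @ [a])) / of_nat (?p u) = (of_nat (\<theta> (u @ [a])) :: rat)" if "u \<in> lists S" for u a
    using ppos[OF that] by simp
  have Rv: "of_nat (?p (u @ x)) / of_nat (?p u) = (of_nat (?p (v @ x)) / of_nat (?p v) :: rat)"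
    "of_nat (?p u) * (f (u @ x) - f u) = of_nat (?p v) * (f (v @ x) - f v)"
    if "?R u = ?R v" "x \<in> lists S" for u v x
    using fun_cong[OF that(1), of x] that(2) by (auto simp: residual_def)
  \<comment> \<open>Equality of residuals is a right congruence, which makes the quotient automaton
    well defined.\<close>
  have same: "\<theta> (u @ [a]) = \<theta> (v @ [a])"
      "of_nat (?p u) * (f (u @ [a]) - f u) = of_nat (?p v) * (f (v @ [a]) - f v)"
      "?R (u @ [a]) = ?R (v @ [a])"
    if R: "?R u = ?R v" and uv: "u \<in> lists S" "v \<in> lists S" and a: "a \<in> S" for u v a
  proof -
    have al: "[a] \<in> lists S" using a by simp
    have "(of_nat (\<theta> (u @ [a])) :: rat) = of_nat (\<theta> (v @ [a]))"
      using Rv(1)[OF R al] th uv by simp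
    then show eq: "\<theta> (u @ [a]) = \<theta> (v @ [a])" by (simp only: of_nat_eq_iff)
    show w: "of_nat (?p u) * (f (u @ [a]) - f u) = of_nat (?p v) * (f (v @ [a]) - f v)"
      using Rv(2)[OF R al] .
    show "?R (u @ [a]) = ?R (v @ [a])"
    proof
      fix x
      show "?R (u @ [a]) x = ?R (v @ [a]) x"
      proof (cases "x \<in> lists S")
        case True
        then have ax: "a # x \<in> lists S" using a by simp
        have "of_nat (?p (u @ a # x)) / of_nat (?p (u @ [a])) =
              (of_nat (?p (v @ a # x)) / of_nat (?p (v @ [a])) :: rat)"
          using Rv(1)[OF R ax] eq by (simp add: divide_divide_eq_left[symmetric] del: divide_divide_eq_left)
        \<comment> \<open>The cost of \<open>x\<close> after \<open>u @ [a]\<close> is that of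
          \<open>a # x\<close> after \<open>u\<close> minus that of \<open>a\<close>, rescaled by
          the new discount factor.\<close>
        moreover have "of_nat (?p (u @ [a])) * (f (u @ a # x) - f (u @ [a])) =
              of_nat (\<theta> (u @ [a])) * (of_nat (?p u) * (f (u @ a # x) - f u) - of_nat (?p u) * (f (u @ [a]) - f u))"
          for u by (simp add: algebra_simps)
        ultimately show ?thesis using Rv(2)[OF R ax] w eq True by (simp add: residual_def del: discount_product_snoc)
      qed (simp add: residual_def)
    qed
  qed
  \<comment> \<open>Weights and discount factors are read off an arbitrary representative of each
    class; by \<open>same\<close> the choice does not matter.\<close>
  define rep where "rep s = (SOME u. u \<in> lists S \<and> st u = s)" for s
  have rep: "rep s \<in> lists S" "st (rep s) = s" if "s \<in> st ` lists S" for s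
  proof -
    have "\<exists>u. u \<in> lists S \<and> st u = s" using that by auto
    then have "rep s \<in> lists S \<and> st (rep s) = s" unfolding rep_def by (rule someI_ex)
    then show "rep s \<in> lists S" "st (rep s) = s" by auto
  qed
  have repR: "?R (rep (st u)) = ?R u" "rep (st u) \<in> lists S" if "u \<in> lists S" for u
    using rep[of "st u"] that st_eq by auto
  define D :: "('a, nat) nmda" where "D = \<lparr> alphabet = S, states = st ` lists S, initials = {st []},
     transitions = {(s, a, q). s \<in> st ` lists S \<and> a \<in> S \<and> q = st (rep s @ [a])},
     weight = (\<lambda>(s, a, _). of_nat (?p (rep s)) * (f (rep s @ [a]) - f (rep s))),
     discount = (\<lambda>(s, a, _). of_nat (\<theta> (rep s @ [a]))) \<rparr>"
  have snoc_eq: "st (rep (st u) @ [a]) = st (u @ [a])" if "u \<in> lists S" "a \<in> S" for u a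
    using same(3)[OF repR(1) repR(2)] that st_eq[of "rep (st u) @ [a]" "u @ [a]"] repR(2) by auto
  have trans: "(st u, a, q) \<in> transitions D \<longleftrightarrow> a \<in> S \<and> q = st (u @ [a])" if "u \<in> lists S" for u a q
    using snoc_eq[OF that] that by (auto simp only: D_def nmda.simps mem_Collect_eq prod.case)
  have wD: "weight D (st u, a, q) = of_nat (?p u) * (f (u @ [a]) - f u)"
    and dD: "discount D (st u, a, q) = of_nat (\<theta> (u @ [a]))" if "u \<in> lists S" "a \<in> S" for u a q
    using same(1,2)[OF repR(1) repR(2) that(1,2)] that by (auto simp: D_def)
  have fin_st: "finite (st ` lists S)" using fin unfolding st_def by (metis finite_imageI image_image)
  have tcases: "\<exists>u\<in>lists S. \<exists>a\<in>S. t = (st u, a, st (u @ [a]))" if "t \<in> transitions D" for t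
  proof -
    obtain s a q where t: "t = (s, a, q)" by (cases t)
    then have "s \<in> st ` lists S" using that unfolding D_def by simp
    then obtain u where u: "u \<in> lists S" "s = st u" by (rule imageE)
    then show ?thesis using trans[OF u(1)] that t by blast
  qed
  have N: "is_NMDA D" unfolding is_NMDA_def
  proof (intro conjI ballI)
    show "transitions D \<subseteq> states D \<times> alphabet D \<times> states D"
    proof
      fix t assume "t \<in> transitions D"
      then obtain u a where "u \<in> lists S" "a \<in> S" "t = (st u, a, st (u @ [a]))" using tcases by blast
      moreover have "st (u @ [a]) \<in> st ` lists S" using calculation by (intro imageI) auto
      ultimately show "t \<in> states D \<times> alphabet D \<times> states D" by (auto simp: D_def)
    qed
    show "1 < discount D t" if t: "t \<in> transitions D" for t
    proof -
      obtain u a where "u \<in> lists S" "a \<in> S" "t = (st u, a, st (u @ [a]))" using tcases[OF t] by blast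
      then show ?thesis using dD theta2 by simp
    qed
    show "\<exists>q'. (q, a, q') \<in> transitions D" if "q \<in> states D" "a \<in> alphabet D" for q a
      using that by (auto simp: D_def)
    show "initials D \<subseteq> states D" by (auto simp: D_def)
  qed (use S fin_st in \<open>auto simp: D_def\<close>)
  have I: "integral_NMDA D" unfolding integral_NMDA_def
  proof (intro conjI ballI N)
    fix t assume "t \<in> transitions D"
    then show "discount D t \<in> \<int>" using tcases[of t] dD by force
  qed
  have run: "last ps = st w" if "fin_run D w ps" "w \<in> lists S" for w ps
    using that
  proof (induction w arbitrary: ps rule: rev_induct)
    case Nil then show ?case by (auto simp: fin_run_Nil D_def)
  next
    case (snoc a w)
    from snoc.prems(1) obtain ps' q where ps: "ps = ps' @ [q]" "fin_run D w ps'" "(last ps', a, q) \<in> transitions D"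
      by (rule fin_run_snocE)
    then show ?case using snoc trans by auto
  qed
  have last_step: "step ((!) (ps @ [q])) ((!) (w @ [a])) (length w) = (st w, a, q)"
    if "fin_run D w ps" "w \<in> lists S" for w ps a q
    using run[OF that] that last_eq_nth[of ps "length w"] by (simp add: fin_run_def step_def nth_append)
  have disc: "discount D (step ((!) ps) ((!) u) (length u - 1)) = of_nat (\<theta> u)"
    if u: "u \<in> lists S" "u \<noteq> []" and r: "fin_run D u ps" for u ps
  proof -
    obtain w a where wa: "u = w @ [a]" using u(2) by (metis append_butlast_last_id)
    obtain ps' q where ps: "ps = ps' @ [q]" "fin_run D w ps'" using r unfolding wa by (rule fin_run_snocE)
    show ?thesis using last_step[OF ps(2)] u dD wa ps by simp
  qed
  have "theta_DMDA S \<theta> D"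
    unfolding theta_DMDA_def theta_NMDA_def is_DMDA_def
    using N I \<theta> disc by (auto simp: D_def)
  moreover have "fin_value D w = of_rat (f w)" if w: "w \<in> lists S" for w
  proof -
    \<comment> \<open>The product of inverse discount factors is carried through the induction
      because it multiplies the next weight and cancels the rescaling by
      \<open>?p w\<close>.\<close>
    have val: "fin_run_value D w ps = of_rat (f w) \<and>
        (\<Prod>j<length w. 1 / of_rat (discount D (step ((!) ps) ((!) w) j)) :: real) = 1 / of_nat (?p w)"
      if "fin_run D w ps" for ps
      using that w
    proof (induction w arbitrary: ps rule: rev_induct)
      case Nil then show ?case by (simp add: fin_run_value_def f0)
    next
      case (snoc a w)
      from snoc.prems(1) obtain ps' q where ps: "ps = ps' @ [q]" "fin_run D w ps'" "(last ps', a, q) \<in> transitions D"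
        by (rule fin_run_snocE)
      have w: "w \<in> lists S" "a \<in> S" using snoc.prems by auto
      have len: "length ps' = Suc (length w)" using ps by (simp add: fin_run_def)
      note IH = snoc.IH[OF ps(2) w(1)]
      have eq: "step ((!) (ps' @ [q])) ((!) (w @ [a])) j = step ((!) ps') ((!) w) j" if "j < length w" for j
        using that len by (simp add: step_def nth_append)
      have "(\<Prod>j<length w. 1 / of_rat (discount D (step ((!) ps) ((!) (w @ [a])) j)) :: real) = 1 / of_nat (?p w)"
        using IH eq by (simp add: ps(1))
      then have 2: "(\<Prod>j<length (w @ [a]). 1 / of_rat (discount D (step ((!) ps) ((!) (w @ [a])) j)) :: real) = 1 / of_nat (?p (w @ [a]))"
        using last_step[OF ps(2) w(1)] dD[OF w] by (simp add: ps(1))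
      have "fin_run_value D (w @ [a]) ps = of_rat (f w) + of_rat (of_nat (?p w) * (f (w @ [a]) - f w)) * (1 / of_nat (?p w))"
        using fin_run_value_snoc[OF len, of D a q] IH run[OF ps(2) w(1)] wD[OF w] by (simp add: ps(1))
      also have "\<dots> = of_rat (f (w @ [a]))"
        using ppos[OF w(1)] by (simp add: of_rat_mult of_rat_diff)
      finally show ?case using 2 by simp
    qed
    obtain ps where ps: "fin_run D w ps" using ex_fin_run[OF N] w by (auto simp: D_def)
    then show ?thesis using fin_value_eqI[OF ps] val by simp
  qed
  moreover have "card (states D) = card (?R ` lists S)"
    using card_image[OF g] by (simp add: D_def st_def image_image)
  moreover have "card (transitions D) = card (states D) * card S"
  proof -
    have "inj_on (\<lambda>(s, a). (s, a, st (rep s @ [a]))) (st ` lists S \<times> S)" by (auto simp: inj_on_def)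
    moreover have "transitions D = (\<lambda>(s, a). (s, a, st (rep s @ [a]))) ` (st ` lists S \<times> S)"
      by (auto simp: D_def)
    ultimately show ?thesis by (simp add: card_image D_def card_cartesian_product)
  qed
  moreover have "\<exists>u\<in>lists S. \<exists>a\<in>S.
           weight D t = of_nat (?p u) * (f (u @ [a]) - f u) \<and> discount D t = of_nat (\<theta> (u @ [a]))"
    if t: "t \<in> transitions D" for t
    using tcases[OF t] wD dD by blast
  ultimately show thesis by (rule that)
qed

subsection \<open>Scaled costs and gaps\<close>

lemma Lcm_int_pos:
  fixes X :: "int set"
  assumes "finite X" "0 \<notin> X"
  shows "Lcm X > 0"
proof -
  have "Lcm X \<noteq> 0" using Lcm_0_iff[OF assms(1)] assms(2) by simp
  then show ?thesis using Lcm_int_greater_eq_0[of X] by linarith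
qed

lemma common_denominator_pos: "finite (transitions A) \<Longrightarrow> common_denominator A > 0"
  unfolding common_denominator_def
  using quotient_of_denom_pos' by (intro Lcm_int_pos) (auto, metis less_irrefl)

lemma weight_times_common_denominator:
  assumes "t \<in> transitions A"
  shows "weight A t * of_int (common_denominator A) \<in> \<int>"
proof -
  obtain p k where pk: "quotient_of (weight A t) = (p, k)" by (metis surj_pair)
  have "k dvd common_denominator A"
    unfolding common_denominator_def using assms pk by (intro dvd_Lcm) (force intro!: image_eqI[of _ _ t])
  then obtain j where "common_denominator A = k * j" by auto
  moreover have "weight A t = of_int p / of_int k" "k > 0"
    using quotient_of_div[OF pk] quotient_of_denom_pos[OF pk] by auto
  ultimately have "weight A t * of_int (common_denominator A) = of_int (p * j)" by simp
  then show ?thesis by (metis Ints_of_int)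
qed

lemma nmda_size_bounds:
  assumes "is_NMDA A"
  shows "card (transitions A) \<le> nmda_size A"
    and "t \<in> transitions A \<Longrightarrow> weight_length A t \<le> nmda_size A"
    and "t \<in> transitions A \<Longrightarrow> discount_length A t \<le> nmda_size A"
  unfolding nmda_size_def using finite_transitions[OF assms] by (auto intro!: Max_ge)

lemma int_length_bound: "int_length z \<le> k \<Longrightarrow> \<bar>z\<bar> < 2 ^ k"
proof -
  assume "int_length z \<le> k"
  then have "floorlog 2 (nat \<bar>z\<bar>) \<le> k" by (simp add: int_length_def)
  then have "nat \<bar>z\<bar> < 2 ^ k" by (rule floorlog_leD) simp
  then have "int (nat \<bar>z\<bar>) < int (2 ^ k)" by (simp only: of_nat_less_iff)
  then show ?thesis by simp
qed

section \<open>Paths with integral scaled costs\<close>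

locale theta_automaton =
  fixes S :: "'a set" and \<theta> :: "'a list \<Rightarrow> nat" and A :: "('a, 's) nmda"
  assumes theta: "theta_NMDA S \<theta> A"
begin

lemma alphabet: "alphabet A = S"
  and choice: "discount_choice S \<theta>"
  and integral: "integral_NMDA A"
  and nmda: "is_NMDA A"
  using theta by (auto simp: theta_NMDA_def integral_NMDA_def)

definition den :: int where "den = common_denominator A"
text \<open>Bounds \<open>\<bar>wt t\<bar>\<close> on transitions, as \<open>wt t\<close> is written
  with at most \<open>nmda_size A\<close> bits.\<close>

definition bnd :: int where "bnd = 2 ^ nmda_size A"
text \<open>The floors in \<open>wt\<close> and \<open>dc\<close> are exact on transitions: clearing
  the common denominator leaves an integer, and discount factors are integers.\<close>

definition wt :: "'s \<times> 'a \<times> 's \<Rightarrow> int" where "wt t = \<lfloor>weight A t * of_int den\<rfloor>"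
definition dc :: "'s \<times> 'a \<times> 's \<Rightarrow> int" where "dc t = \<lfloor>discount A t\<rfloor>"

lemma den_pos: "den > 0"
  unfolding den_def using common_denominator_pos finite_transitions[OF nmda] .

lemma weight_eq: "t \<in> transitions A \<Longrightarrow> weight A t = of_int (wt t) / of_int den"
  using weight_times_common_denominator[of t A] den_pos
  by (auto simp: wt_def den_def[symmetric] field_simps elim!: Ints_cases)

lemma wt_bound: "t \<in> transitions A \<Longrightarrow> \<bar>wt t\<bar> \<le> bnd"
proof -
  assume "t \<in> transitions A"
  then have "int_length (wt t) \<le> nmda_size A"
    using nmda_size_bounds(2)[OF nmda] by (fastforce simp: weight_length_def wt_def den_def)
  then show ?thesis using int_length_bound by (fastforce simp: bnd_def)
qed

lemma bnd_pos: "bnd > 0" by (simp add: bnd_def)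

lemma discount_eq: "t \<in> transitions A \<Longrightarrow> discount A t = of_int (dc t)"
  using integral by (auto simp: integral_NMDA_def dc_def elim!: Ints_cases dest!: bspec)

lemma dc_ge_2: "t \<in> transitions A \<Longrightarrow> dc t \<ge> 2"
  using discount_ge_2[OF integral] discount_eq by fastforce

text \<open>\<open>path p u q c r\<close>: some path from \<open>p\<close> to \<open>q\<close> on \<open>u\<close> has product \<open>r\<close> of discount factors and
  value \<open>c / (den * r)\<close>. With this scaling \<open>c\<close> is an integer.\<close>

inductive path :: "'s \<Rightarrow> 'a list \<Rightarrow> 's \<Rightarrow> int \<Rightarrow> int \<Rightarrow> bool" where
  path_Nil: "path p [] p 0 1"
| path_snoc: "path p u q c r \<Longrightarrow> (q, a, q') \<in> transitions A \<Longrightarrow>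
    path p (u @ [a]) q' (dc (q, a, q') * (c + wt (q, a, q'))) (r * dc (q, a, q'))"

lemma path_NilE: "path p [] q c r \<Longrightarrow> q = p \<and> c = 0 \<and> r = 1"
  by (erule path.cases) auto

lemma path_snocE:
  assumes "path p (u @ [a]) q' c' r'"
  obtains q c r where "path p u q c r" "(q, a, q') \<in> transitions A"
    "c' = dc (q, a, q') * (c + wt (q, a, q'))" "r' = r * dc (q, a, q')"
  using assms by (rule path.cases) auto

text \<open>Over the denominator \<open>den * (r * r')\<close> the first numerator gains the factor
  \<open>r'\<close>; the second stays, since its delay by \<open>r\<close> is already in the
  denominator.\<close>

lemma path_append:
  assumes "path p u q c r" "path q v s c' r'"
  shows "path p (u @ v) s (r' * c + c') (r * r')"
  using assms(2,1)
proof (induction rule: path.induct)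
  case (path_snoc q v s c' r' a s')
  have "path p ((u @ v) @ [a]) s' (dc (s, a, s') * (r' * c + c' + wt (s, a, s'))) (r * r' * dc (s, a, s'))"
    using path_snoc by (intro path.path_snoc) auto
  then show ?case by (simp add: algebra_simps)
qed simp

lemma path_split:
  assumes "path p (u @ v) s c r"
  obtains q c1 r1 c2 r2 where "path p u q c1 r1" "path q v s c2 r2" "c = r2 * c1 + c2" "r = r1 * r2"
  using assms
proof (induction v arbitrary: s c r thesis rule: rev_induct)
  case Nil
  then show ?case using path_Nil[of s] by (metis add.right_neutral append_Nil2 mult.right_neutral mult_1)
next
  case (snoc a v)
  from snoc.prems(2) have "path p ((u @ v) @ [a]) s c r" by simp
  then obtain q' c' r' where 1: "path p (u @ v) q' c' r'" "(q', a, s) \<in> transitions A"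
    "c = dc (q', a, s) * (c' + wt (q', a, s))" "r = r' * dc (q', a, s)" by (rule path_snocE)
  obtain q c1 r1 c2 r2 where 2: "path p u q c1 r1" "path q v q' c2 r2" "c' = r2 * c1 + c2" "r' = r1 * r2"
    using snoc.IH[OF _ 1(1)] by blast
  show ?case
    by (rule snoc.prems(1)[OF 2(1) path_snoc[OF 2(2) 1(2)]]) (simp_all add: 1 2 algebra_simps)
qed

lemma path_lists: "path p u q c r \<Longrightarrow> u \<in> lists S"
  by (induction rule: path.induct) (use nmda alphabet in \<open>auto simp: is_NMDA_def\<close>)

lemma path_states: "path p u q c r \<Longrightarrow> p \<in> states A \<Longrightarrow> q \<in> states A"
  by (induction rule: path.induct) (use nmda in \<open>auto simp: is_NMDA_def\<close>)

lemma path_factor: "path p u q c r \<Longrightarrow> r \<ge> 2 ^ length u"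
proof (induction rule: path.induct)
  case (path_snoc p u q c r a q')
  have "r * dc (q, a, q') \<ge> 2 ^ length u * 2"
    using path_snoc dc_ge_2[of "(q, a, q')"] order_trans[OF zero_le_power[of "2::int" "length u"]]
    by (intro mult_mono) auto
  then show ?case by simp
qed simp

lemma path_factor_pos: "path p u q c r \<Longrightarrow> r \<ge> 1"
  using path_factor[of p u q c r] one_le_power[of "2::int" "length u"] by linarith

text \<open>A geometric series with ratio at most 1/2, in scaled form. The summand
  \<open>- 1\<close> lets the induction close, since \<open>dc t \<ge> 2\<close> absorbs the new
  weight.\<close>

lemma path_bound: "path p u q c r \<Longrightarrow> \<bar>c\<bar> \<le> 2 * bnd * (r - 1)"
proof (induction rule: path.induct)
  case (path_snoc p u q c r a q')
  define t where "t = (q, a, q')"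
  have t: "dc t \<ge> 2" "\<bar>wt t\<bar> \<le> bnd" using path_snoc dc_ge_2 wt_bound by (auto simp: t_def)
  have "\<bar>dc t * (c + wt t)\<bar> = dc t * \<bar>c + wt t\<bar>" using t by (simp add: abs_mult)
  also have "\<dots> \<le> dc t * (2 * bnd * (r - 1) + bnd)"
    using t path_snoc.IH by (intro mult_left_mono) linarith+
  also have "\<dots> = 2 * bnd * (r * dc t) - bnd * dc t" by (simp add: algebra_simps)
  also have "\<dots> \<le> 2 * bnd * (r * dc t) - bnd * 2" using bnd_pos t by simp
  also have "\<dots> = 2 * bnd * (r * dc t - 1)" by (simp add: algebra_simps)
  finally show ?case by (simp add: t_def)
qed simp

text \<open>Ensures that the minima defining \<open>best\<close>, \<open>best_to\<close> and
  \<open>leap\<close> range over finite sets.\<close>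

lemma finite_paths: "finite {(q, c, r). path p u q c r}"
proof (induction u rule: rev_induct)
  case Nil
  have "{(q, c, r). path p [] q c r} \<subseteq> {(p, 0, 1)}" by (auto dest: path_NilE)
  then show ?case by (rule finite_subset) simp
next
  case (snoc a u)
  have "{(q, c, r). path p (u @ [a]) q c r} \<subseteq>
    (\<lambda>((q, c, r), t). (snd (snd t), dc t * (c + wt t), r * dc t)) `
      ({(q, c, r). path p u q c r} \<times> transitions A)"
  proof clarify
    fix q' c' r' assume "path p (u @ [a]) q' c' r'"
    then obtain q c r where "path p u q c r" "(q, a, q') \<in> transitions A"
      "c' = dc (q, a, q') * (c + wt (q, a, q'))" "r' = r * dc (q, a, q')" by (rule path_snocE)
    then show "(q', c', r') \<in> (\<lambda>((q, c, r), t). (snd (snd t), dc t * (c + wt t), r * dc t)) `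
      ({(q, c, r). path p u q c r} \<times> transitions A)"
      by (intro image_eqI[of _ _ "((q, c, r), (q, a, q'))"]) auto
  qed
  then show ?case using snoc finite_transitions[OF nmda] by (auto intro: finite_subset)
qed

lemma ex_path:
  assumes "p \<in> states A" "v \<in> lists S"
  shows "\<exists>q c r. path p v q c r"
  using assms(2)
proof (induction v rule: rev_induct)
  case Nil show ?case using path_Nil by blast
next
  case (snoc a v)
  then obtain q c r where *: "path p v q c r" by auto
  then have "q \<in> states A" using assms(1) by (rule path_states)
  then obtain q' where "(q, a, q') \<in> transitions A"
    using successor_exists[OF nmda, of q a] snoc.prems alphabet by auto
  then show ?case using path_snoc[OF *] by blast
qed

section \<open>Runs as paths from initial states\<close>

abbreviation \<rho> :: "'a list \<Rightarrow> nat" where "\<rho> \<equiv> discount_product \<theta>"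

lemma \<rho>_pos: "u \<in> lists S \<Longrightarrow> \<rho> u > 0"
  by (rule discount_product_pos[OF choice])

text \<open>The transition ends a run on \<open>u @ [a]\<close>, to which the defining property of a
  \<open>\<theta>\<close>-NMDA applies.\<close>

lemma last_discount:
  assumes "fin_run A u ps" "u \<in> lists S" "(last ps, a, q) \<in> transitions A"
  shows "dc (last ps, a, q) = int (\<theta> (u @ [a]))"
proof -
  have len: "length ps = Suc (length u)" using assms(1) by (simp add: fin_run_def)
  have "a \<in> S" using assms(3) nmda alphabet by (auto simp: is_NMDA_def)
  then have "u @ [a] \<in> lists S" using assms by simp
  moreover have "fin_run A (u @ [a]) (ps @ [q])" using assms by (simp add: fin_run_snoc)
  ultimately have "discount A (step ((!) (ps @ [q])) ((!) (u @ [a])) (length (u @ [a]) - 1)) = of_nat (\<theta> (u @ [a]))"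
    using theta unfolding theta_NMDA_def by blast
  moreover have "step ((!) (ps @ [q])) ((!) (u @ [a])) (length u) = (last ps, a, q)"
    using len last_eq_nth[OF len] by (simp add: step_def nth_append)
  ultimately have "discount A (last ps, a, q) = of_nat (\<theta> (u @ [a]))" by simp
  then show ?thesis by (simp add: dc_def)
qed

lemma run_value_snoc:
  assumes "fin_run A u ps" "(last ps, a, q) \<in> transitions A"
    and "fin_run_value A u ps = of_int c / (of_int den * of_int r)"
    and "(\<Prod>j<length u. 1 / of_rat (discount A (step ((!) ps) ((!) u) j)) :: real) = 1 / of_int r"
  shows "fin_run_value A (u @ [a]) (ps @ [q]) =
      of_int (dc (last ps, a, q) * (c + wt (last ps, a, q))) / (of_int den * of_int (r * dc (last ps, a, q)))"
    and "(\<Prod>j<length (u @ [a]). 1 / of_rat (discount A (step ((!) (ps @ [q])) ((!) (u @ [a])) j)) :: real) =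
      1 / of_int (r * dc (last ps, a, q))"
proof -
  let ?t = "(last ps, a, q)"
  have len: "length ps = Suc (length u)" using assms(1) by (simp add: fin_run_def)
  have dc0: "real_of_int (dc ?t) \<noteq> 0" using dc_ge_2[OF assms(2)] by simp
  have eq: "step ((!) (ps @ [q])) ((!) (u @ [a])) j = step ((!) ps) ((!) u) j" if "j < length u" for j
    using that len by (simp add: step_def nth_append)
  have l: "step ((!) (ps @ [q])) ((!) (u @ [a])) (length u) = ?t"
    using len last_eq_nth[OF len] by (simp add: step_def nth_append)
  show "(\<Prod>j<length (u @ [a]). 1 / of_rat (discount A (step ((!) (ps @ [q])) ((!) (u @ [a])) j)) :: real) =
      1 / of_int (r * dc ?t)"
    using assms(4) eq by (simp add: l discount_eq[OF assms(2)])
  have w: "of_rat (weight A ?t) = (of_int (wt ?t) / of_int den :: real)"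
    by (simp add: weight_eq[OF assms(2)] of_rat_divide)
  have "fin_run_value A (u @ [a]) (ps @ [q]) =
     of_int c / (of_int den * of_int r) + of_int (wt ?t) / of_int den * (1 / of_int r)"
    using fin_run_value_snoc[OF len, of A a q] assms(3,4) w by simp
  also have "\<dots> = of_int (c + wt ?t) / (of_int den * of_int r)"
    by (simp add: add_divide_distrib)
  also have "\<dots> = of_int (dc ?t * (c + wt ?t)) / (of_int den * of_int (r * dc ?t))"
    using dc0 by simp
  finally show "fin_run_value A (u @ [a]) (ps @ [q]) = \<dots>" .
qed

lemma path_of_run:
  assumes "fin_run A u ps"
  shows "\<exists>c r. path (ps ! 0) u (last ps) c r \<and>
    fin_run_value A u ps = of_int c / (of_int den * of_int r) \<and>
    (\<Prod>j<length u. 1 / of_rat (discount A (step ((!) ps) ((!) u) j)) :: real) = 1 / of_int r"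
  using assms
proof (induction u arbitrary: ps rule: rev_induct)
  case Nil
  then obtain p where "ps = [p]" by (auto simp: fin_run_Nil)
  then show ?case using path_Nil[of p] by (intro exI[of _ 0] exI[of _ 1]) (simp add: fin_run_value_def)
next
  case (snoc a u)
  from snoc.prems obtain ps' q where ps: "ps = ps' @ [q]" "fin_run A u ps'" "(last ps', a, q) \<in> transitions A"
    by (rule fin_run_snocE)
  obtain c r where cr: "path (ps' ! 0) u (last ps') c r"
    "fin_run_value A u ps' = of_int c / (of_int den * of_int r)"
    "(\<Prod>j<length u. 1 / of_rat (discount A (step ((!) ps') ((!) u) j)) :: real) = 1 / of_int r"
    using snoc.IH[OF ps(2)] by blast
  have "ps ! 0 = ps' ! 0" using ps by (simp add: fin_run_def nth_append)
  then show ?case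
    using path_snoc[OF cr(1) ps(3)] run_value_snoc[OF ps(2,3) cr(2,3)] unfolding ps(1) last_snoc by metis
qed

text \<open>From an initial state the discount product depends only on the word. Paths from other
  states need not have product \<open>\<rho> u\<close>, which is why \<open>path\<close> carries its
  product as a separate argument.\<close>

lemma run_of_path:
  assumes "path p u q c r" "p \<in> initials A"
  shows "r = int (\<rho> u) \<and> (\<exists>ps. fin_run A u ps \<and> last ps = q \<and>
    fin_run_value A u ps = of_int c / (of_int den * of_int r) \<and>
    (\<Prod>j<length u. 1 / of_rat (discount A (step ((!) ps) ((!) u) j)) :: real) = 1 / of_int r)"
  using assms
proof (induction rule: path.induct)
  case (path_Nil p)
  then show ?case
    by (intro conjI exI[of _ "[p]"]) (auto simp: fin_run_Nil fin_run_value_def)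
next
  case (path_snoc p u q c r a q')
  then obtain ps where ps: "fin_run A u ps" "last ps = q"
    "fin_run_value A u ps = of_int c / (of_int den * of_int r)"
    "(\<Prod>j<length u. 1 / of_rat (discount A (step ((!) ps) ((!) u) j)) :: real) = 1 / of_int r" by blast
  have t: "(last ps, a, q') \<in> transitions A" using ps path_snoc by simp
  have "fin_run A (u @ [a]) (ps @ [q'])" using ps t by (simp add: fin_run_snoc)
  moreover have "r * dc (q, a, q') = int (\<rho> (u @ [a]))"
    using last_discount[OF ps(1) path_lists[OF path_snoc.hyps(1)] t] path_snoc ps(2) by simp
  ultimately show ?case
    using run_value_snoc[OF ps(1) t ps(3,4)] unfolding ps(2) by (metis last_snoc)
qed

definition ipath :: "'a list \<Rightarrow> 's \<Rightarrow> int \<Rightarrow> bool" where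
  "ipath u q c \<longleftrightarrow> (\<exists>p\<in>initials A. path p u q c (int (\<rho> u)))"

lemma ipathI: "p \<in> initials A \<Longrightarrow> path p u q c r \<Longrightarrow> ipath u q c"
  using run_of_path unfolding ipath_def by blast

lemma ipath_lists: "ipath u q c \<Longrightarrow> u \<in> lists S"
  unfolding ipath_def using path_lists by blast

lemma ipath_states: "ipath u q c \<Longrightarrow> q \<in> states A"
  unfolding ipath_def using path_states nmda unfolding is_NMDA_def by blast

lemma ipath_append:
  assumes "ipath u q c" "path q v s c' r"
  shows "ipath (u @ v) s (r * c + c')" "int (\<rho> (u @ v)) = int (\<rho> u) * r"
proof -
  obtain p where p: "p \<in> initials A" "path p u q c (int (\<rho> u))" using assms(1) by (auto simp: ipath_def)
  note * = path_append[OF p(2) assms(2)]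
  show "ipath (u @ v) s (r * c + c')" using p(1) * by (rule ipathI)
  show "int (\<rho> (u @ v)) = int (\<rho> u) * r" using run_of_path[OF * p(1)] by simp
qed

lemma ipath_split:
  assumes "ipath (u @ v) s c"
  obtains q c1 c2 r where "ipath u q c1" "path q v s c2 r" "c = r * c1 + c2"
    "int (\<rho> (u @ v)) = int (\<rho> u) * r"
proof -
  obtain p where p: "p \<in> initials A" "path p (u @ v) s c (int (\<rho> (u @ v)))"
    using assms by (auto simp: ipath_def)
  obtain q c1 r1 c2 r2 where *: "path p u q c1 r1" "path q v s c2 r2" "c = r2 * c1 + c2"
      "int (\<rho> (u @ v)) = r1 * r2"
    using p(2) by (rule path_split)
  have "r1 = int (\<rho> u)" using run_of_path[OF *(1) p(1)] by simp
  with * show thesis using that ipathI[OF p(1) *(1)] by simp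
qed

lemma ex_ipath: "u \<in> lists S \<Longrightarrow> \<exists>q c. ipath u q c"
proof -
  assume u: "u \<in> lists S"
  obtain p where p: "p \<in> initials A" "p \<in> states A" using nmda by (auto simp: is_NMDA_def)
  then show ?thesis using ex_path[OF p(2) u] ipathI[OF p(1)] by blast
qed

section \<open>Optimal costs and truncated gaps\<close>

definition best :: "'a list \<Rightarrow> int" where "best u = Min {c. \<exists>q. ipath u q c}"
text \<open>Meaningful only for a state \<open>q\<close> that is reached on \<open>u\<close>;
  otherwise the minimum is over the empty set.\<close>

definition best_to :: "'a list \<Rightarrow> 's \<Rightarrow> int" where "best_to u q = Min {c. ipath u q c}"

lemma finite_ipath: "finite {c. \<exists>q. ipath u q c}" "finite {c. ipath u q c}"
proof -
  have I: "finite (initials A)" using nmda finite_subset by (auto simp: is_NMDA_def)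
  have "{c. \<exists>q. ipath u q c} \<subseteq> (\<Union>p\<in>initials A. (\<lambda>(q, c, r). c) ` {(q, c, r). path p u q c r})"
    by (force simp: ipath_def)
  then show 1: "finite {c. \<exists>q. ipath u q c}"
    by (rule finite_subset) (use I finite_paths in blast)
  show "finite {c. ipath u q c}" by (rule finite_subset[OF _ 1]) auto
qed

lemma best_le: "ipath u q c \<Longrightarrow> best u \<le> c"
  unfolding best_def using finite_ipath by (intro Min_le) auto

lemma best_attained: "u \<in> lists S \<Longrightarrow> \<exists>q. ipath u q (best u)"
  using Min_in[OF finite_ipath(1)[of u]] ex_ipath unfolding best_def by blast

lemma best_to_le: "ipath u q c \<Longrightarrow> best_to u q \<le> c"
  unfolding best_to_def using finite_ipath by (intro Min_le) auto

lemma best_to_attained: "ipath u q c \<Longrightarrow> ipath u q (best_to u q)"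
  using Min_in[OF finite_ipath(2)[of u q]] unfolding best_to_def by blast

text \<open>The value of a word with the scaling by \<open>den\<close> and \<open>\<rho> u\<close>
  undone; it is rational because its increments become weights.\<close>

definition val :: "'a list \<Rightarrow> rat" where
  "val u = of_int (best u) / (of_int den * of_nat (\<rho> u))"

text \<open>All runs on \<open>u\<close> share the denominator \<open>den * \<rho> u\<close>, so
  comparing values is comparing integers, and the infimum is attained.\<close>

lemma fin_value_eq:
  assumes u: "u \<in> lists S"
  shows "fin_value A u = of_rat (val u)"
proof -
  obtain q where "ipath u q (best u)" using best_attained[OF u] by blast
  then obtain p where p: "p \<in> initials A" "path p u q (best u) (int (\<rho> u))" by (auto simp: ipath_def)
  obtain ps where ps: "fin_run A u ps" "fin_run_value A u ps = of_int (best u) / (of_int den * of_int (int (\<rho> u)))"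
    using run_of_path[OF p(2,1)] by blast
  have "fin_run_value A u ps \<le> fin_run_value A u ps'" if r: "fin_run A u ps'" for ps'
  proof -
    obtain c r where cr: "path (ps' ! 0) u (last ps') c r"
      "fin_run_value A u ps' = of_int c / (of_int den * of_int r)"
      using path_of_run[OF r] by blast
    have i: "ps' ! 0 \<in> initials A" using r by (simp add: fin_run_def)
    have "r = int (\<rho> u)" using run_of_path[OF cr(1) i] by simp
    moreover have "best u \<le> c" using ipathI[OF i cr(1)] by (rule best_le)
    ultimately show ?thesis using den_pos by (simp add: ps(2) cr(2) divide_right_mono)
  qed
  then have "fin_value A u = fin_run_value A u ps" by (rule fin_value_eqI[OF ps(1)])
  then show ?thesis using ps(2) by (simp add: val_def of_rat_divide of_rat_mult)
qed

text \<open>A gap of at least \<open>4 * bnd\<close> can never be recovered from.\<close>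

definition gap :: "'a list \<Rightarrow> 's \<Rightarrow> int option" where
  "gap u q = (if \<exists>c. ipath u q c \<and> c - best u < 4 * bnd then Some (best_to u q - best u) else None)"

lemma gap_SomeD:
  assumes "gap u q = Some g"
  shows "ipath u q (best u + g)" "0 \<le> g" "g < 4 * bnd" "best_to u q = best u + g"
proof -
  obtain c where c: "ipath u q c" "c - best u < 4 * bnd" "g = best_to u q - best u"
    using assms by (auto simp: gap_def split: if_splits)
  then show "ipath u q (best u + g)" "0 \<le> g" "g < 4 * bnd" "best_to u q = best u + g"
    using best_to_attained[OF c(1)] best_to_le[OF c(1)] best_le[of u q "best_to u q"] by auto
qed

lemma gap_SomeI: "ipath u q c \<Longrightarrow> c - best u < 4 * bnd \<Longrightarrow> \<exists>g. gap u q = Some g \<and> best u + g \<le> c"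
  using best_to_le[of u q c] by (auto simp: gap_def)

text \<open>Justifies the threshold \<open>4 * bnd\<close>: an excess of that size after
  \<open>u\<close> is multiplied by \<open>r\<close>, whereas two continuations along
  \<open>v\<close> differ by at most \<open>4 * bnd * (r - 1)\<close>. An optimal run can therefore
  be taken through a state with a recorded gap.\<close>

lemma best_via_gap:
  assumes u: "u \<in> lists S" and v: "v \<in> lists S"
  shows "\<exists>q g s c r. gap u q = Some g \<and> path q v s c r \<and> best (u @ v) = r * (best u + g) + c"
proof -
  have "u @ v \<in> lists S" using u v by simp
  then obtain s where s: "ipath (u @ v) s (best (u @ v))" using best_attained by blast
  obtain q c1 c2 r where 1: "ipath u q c1" "path q v s c2 r" "best (u @ v) = r * c1 + c2"
    "int (\<rho> (u @ v)) = int (\<rho> u) * r" using s by (rule ipath_split)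
  have r: "r \<ge> 1" using path_factor_pos[OF 1(2)] .
  show ?thesis
  proof (cases "c1 - best u < 4 * bnd")
    case True
    obtain g where g: "gap u q = Some g" "best u + g \<le> c1" using gap_SomeI[OF 1(1) True] by blast
    have "best (u @ v) \<le> r * (best u + g) + c2"
      by (rule best_le, rule ipath_append(1)[OF gap_SomeD(1)[OF g(1)] 1(2)])
    moreover have "r * (best u + g) \<le> r * c1" using r g(2) by (intro mult_left_mono) auto
    ultimately have "best (u @ v) = r * (best u + g) + c2" using 1(3) by linarith
    then show ?thesis using g 1(2) by blast
  next
    case False
    \<comment> \<open>The run is rerouted through a state \<open>p\<close> of gap 0.\<close>
    obtain p where p: "ipath u p (best u)" using best_attained[OF u] by blast
    obtain g where g: "gap u p = Some g" "best u + g \<le> best u"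
      using gap_SomeI[OF p] bnd_pos by auto
    then have g0: "g = 0" using gap_SomeD(2)[OF g(1)] by simp
    obtain s' c' r' where 2: "path p v s' c' r'" using ex_path[OF ipath_states[OF p] v] by blast
    have "int (\<rho> u) * r' = int (\<rho> u) * r" using ipath_append(2)[OF p 2] 1(4) by (rule trans[OF sym])
    moreover have "int (\<rho> u) \<noteq> 0" using \<rho>_pos[OF u] by simp
    ultimately have rr: "r' = r" by (metis mult_left_cancel)
    have "r * (4 * bnd) \<le> r * (c1 - best u)" using r False by (intro mult_left_mono) auto
    moreover have "\<bar>c2\<bar> \<le> 2 * bnd * (r - 1)" "\<bar>c'\<bar> \<le> 2 * bnd * (r - 1)"
      using path_bound[OF 1(2)] path_bound[OF 2] rr by auto
    ultimately have "r * best u + c' \<le> best (u @ v)" using 1(3) bnd_pos by (simp add: algebra_simps)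
    moreover have "best (u @ v) \<le> r * best u + c'"
      using best_le ipath_append(1)[OF p 2] rr by blast
    ultimately have "best (u @ v) = r' * (best u + g) + c'" using rr g0 by simp
    then show ?thesis using g(1) 2 by blast
  qed
qed

text \<open>An optimal run on \<open>u @ v\<close> can pass through a recorded state
  \<open>q\<close>; the same gap at \<open>q\<close> after \<open>u'\<close> makes the rest of the
  run available there at the same relative cost. Exchanging \<open>u\<close> and \<open>u'\<close>
  gives the converse inequality.\<close>

lemma gap_transfer:
  assumes "gap u = gap u'" "u \<in> lists S" "u' \<in> lists S" "v \<in> lists S"
  shows "\<exists>r>0. int (\<rho> (u @ v)) = int (\<rho> u) * r \<and> int (\<rho> (u' @ v)) = int (\<rho> u') * r \<and>
     best (u' @ v) - r * best u' \<le> best (u @ v) - r * best u"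
proof -
  obtain q g s c r where *: "gap u q = Some g" "path q v s c r" "best (u @ v) = r * (best u + g) + c"
    using best_via_gap[OF assms(2,4)] by blast
  have g': "gap u' q = Some g" using * assms(1) by simp
  have "best (u' @ v) \<le> r * (best u' + g) + c"
    by (rule best_le, rule ipath_append(1)[OF gap_SomeD(1)[OF g'] *(2)])
  moreover have "r > 0" using path_factor_pos[OF *(2)] by simp
  ultimately show ?thesis
    using ipath_append(2)[OF gap_SomeD(1)[OF *(1)] *(2)] ipath_append(2)[OF gap_SomeD(1)[OF g'] *(2)] *(3)
    by (intro exI[of _ r]) (simp add: algebra_simps)
qed

lemma residual_eq_if_gap_eq:
  assumes "gap u = gap u'" "u \<in> lists S" "u' \<in> lists S"
  shows "residual S \<theta> val u = residual S \<theta> val u'"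
proof
  fix v
  show "residual S \<theta> val u v = residual S \<theta> val u' v"
  proof (cases "v \<in> lists S")
    case True
    obtain r where r: "r > 0" "int (\<rho> (u @ v)) = int (\<rho> u) * r" "int (\<rho> (u' @ v)) = int (\<rho> u') * r"
     "best (u' @ v) - r * best u' \<le> best (u @ v) - r * best u"
      using gap_transfer[OF assms True] by blast
    obtain r' where r': "int (\<rho> (u @ v)) = int (\<rho> u) * r'"
     "best (u @ v) - r' * best u \<le> best (u' @ v) - r' * best u'"
      using gap_transfer[OF assms(1)[symmetric] assms(3,2) True] by blast
    have "r' = r" using r(2) r'(1) \<rho>_pos[OF assms(2)] by auto
    then have eq: "best (u' @ v) - r * best u' = best (u @ v) - r * best u" using r(4) r'(2) by simp
    \<comment> \<open>Both components of the residual at \<open>v\<close> are functions of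
      \<open>r\<close> and of \<open>best (x @ v) - r * best x\<close>.\<close>
    have *: "(of_nat (\<rho> (x @ v)) / of_nat (\<rho> x) :: rat) = of_int r \<and>
      of_nat (\<rho> x) * (val (x @ v) - val x) = of_int (best (x @ v) - r * best x) / (of_int den * of_int r)"
      if "x \<in> lists S" "int (\<rho> (x @ v)) = int (\<rho> x) * r" for x
    proof -
      have e: "(of_nat (\<rho> (x @ v)) :: rat) = of_nat (\<rho> x) * of_int r"
        by (metis that(2) of_int_mult of_int_of_nat_eq)
      have p: "(of_nat (\<rho> x) :: rat) \<noteq> 0" using \<rho>_pos[OF that(1)] by simp
      show ?thesis using p r(1) den_pos by (simp add: val_def e field_simps)
    qed
    show ?thesis using *[OF assms(2) r(2)] *[OF assms(3) r(3)] eq True by (simp only: residual_def restrict_apply)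
  qed (simp add: residual_def)
qed

end

subsection \<open>Counting gap vectors\<close>

text \<open>If the argmin functions \<open>\<phi>\<close> and \<open>\<psi>\<close> for two shift vectors \<open>x\<close> and \<open>y\<close> have fibres of equal sizes,
  then summing the two families of inequalities cancels the shifts, so all of them are equalities.\<close>

lemma argmin_exchange:
  fixes M :: "'q \<Rightarrow> 'p \<Rightarrow> 'b::linordered_ab_group_add"
  assumes fin: "finite R"
    and fibres: "image_mset \<phi> (mset_set R) = image_mset \<psi> (mset_set R)"
    and x: "\<And>q. q \<in> R \<Longrightarrow> M q (\<phi> q) + x (\<phi> q) \<le> M q (\<psi> q) + x (\<psi> q)"
    and y: "\<And>q. q \<in> R \<Longrightarrow> M q (\<psi> q) + y (\<psi> q) \<le> M q (\<phi> q) + y (\<phi> q)"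
    and q: "q \<in> R"
  shows "M q (\<phi> q) + x (\<phi> q) = M q (\<psi> q) + x (\<psi> q)"
proof -
  have shift: "(\<Sum>q\<in>R. z (\<phi> q)) = (\<Sum>q\<in>R. z (\<psi> q))" for z :: "'p \<Rightarrow> 'b"
  proof -
    have "(\<Sum>q\<in>R. z (f q)) = sum_mset (image_mset z (image_mset f (mset_set R)))" for f
      by (simp add: sum_unfold_sum_mset multiset.map_comp comp_def)
    then show ?thesis by (simp only: fibres)
  qed
  have "(\<Sum>q\<in>R. M q (\<phi> q) + x (\<phi> q)) \<le> (\<Sum>q\<in>R. M q (\<psi> q) + x (\<psi> q))" by (rule sum_mono) (rule x)
  moreover have "(\<Sum>q\<in>R. M q (\<psi> q) + y (\<psi> q)) \<le> (\<Sum>q\<in>R. M q (\<phi> q) + y (\<phi> q))" by (rule sum_mono) (rule y)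
  ultimately have "(\<Sum>q\<in>R. M q (\<phi> q) + x (\<phi> q)) = (\<Sum>q\<in>R. M q (\<psi> q) + x (\<psi> q))"
    unfolding sum.distrib shift by auto
  then show ?thesis by (rule sum_mono_inv[OF _ x q fin])
qed

text \<open>Stars and bars: a multiset over \<open>Q\<close> is its vector of multiplicities along
  an enumeration \<open>xs\<close> of \<open>Q\<close>, and the binomial coefficient counting these
  vectors is at most a power of two.\<close>

lemma multisets_of_size:
  assumes Q: "finite Q"
  shows "finite {\<mu>. set_mset \<mu> \<subseteq> Q \<and> size \<mu> = N}"
    and "card {\<mu>. set_mset \<mu> \<subseteq> Q \<and> size \<mu> = N} \<le> 2 ^ (N + card Q)"
proof -
  obtain xs where xs: "set xs = Q" "distinct xs" using finite_distinct_list[OF Q] by blast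
  let ?X = "{\<mu>. set_mset \<mu> \<subseteq> Q \<and> size \<mu> = N}" and ?L = "{l :: nat list. length l = card Q \<and> sum_list l = N}"
  let ?f = "\<lambda>\<mu>. map (count \<mu>) xs"
  have inj: "inj_on ?f ?X"
  proof (rule inj_onI)
    fix \<mu> \<nu> assume *: "\<mu> \<in> ?X" "\<nu> \<in> ?X" "?f \<mu> = ?f \<nu>"
    show "\<mu> = \<nu>"
    proof (rule multiset_eqI)
      fix a
      show "count \<mu> a = count \<nu> a"
      proof (cases "a \<in> Q")
        case True
        then show ?thesis using *(3) xs(1) by (metis map_eq_conv)
      next
        case False
        then have "a \<notin># \<mu>" "a \<notin># \<nu>" using * by auto
        then show ?thesis by (simp add: not_in_iff)
      qed
    qed
  qed
  have sub: "?f ` ?X \<subseteq> ?L"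
  proof clarify
    fix \<mu> assume \<mu>: "set_mset \<mu> \<subseteq> Q" "N = size \<mu>"
    have "sum_list (?f \<mu>) = (\<Sum>a\<in>Q. count \<mu> a)"
      using xs by (simp add: sum_list_distinct_conv_sum_set)
    also have "\<dots> = (\<Sum>a\<in>set_mset \<mu>. count \<mu> a)"
      by (rule sum.mono_neutral_right[OF Q \<mu>(1)]) (auto simp: not_in_iff)
    finally show "length (?f \<mu>) = card Q \<and> sum_list (?f \<mu>) = size \<mu>"
      using xs distinct_card by (fastforce simp: size_multiset_overloaded_eq)
  qed
  have finL: "finite ?L"
  proof (rule finite_subset)
    show "?L \<subseteq> {l. set l \<subseteq> {..N} \<and> length l = card Q}" using member_le_sum_list by fastforce
  qed (auto intro: finite_lists_length_eq)
  show "finite ?X" using inj sub finL by (meson finite_imageD finite_subset)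
  have "card ?X \<le> card ?L" using inj sub finL by (rule card_inj_on_le)
  also have "\<dots> = (N + card Q - 1) choose N" by (rule card_length_sum_list)
  also have "\<dots> \<le> 2 ^ (N + card Q - 1)" by (rule binomial_le_pow2)
  also have "\<dots> \<le> 2 ^ (N + card Q)" by (rule power_increasing) auto
  finally show "card ?X \<le> 2 ^ (N + card Q)" .
qed

text \<open>The classifier \<open>z\<close> of \<open>w\<close> need not be unique: one word is
  picked for each \<open>z\<close>, and \<open>unique\<close> ensures that its image is the right
  one.\<close>

lemma card_image_le_classifier:
  assumes Z: "finite Z" and ex: "\<And>w. w \<in> L \<Longrightarrow> \<exists>z\<in>Z. P w z"
    and unique: "\<And>w w' z. P w z \<Longrightarrow> P w' z \<Longrightarrow> g w = g w'"
  shows "finite (g ` L)" "card (g ` L) \<le> card Z"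
proof -
  have sub: "g ` L \<subseteq> (\<lambda>z. g (SOME w. P w z)) ` Z"
  proof clarify
    fix w assume "w \<in> L"
    then obtain z where z: "z \<in> Z" "P w z" using ex by blast
    have "g w = g (SOME w. P w z)" using unique z(2) someI by metis
    with z(1) show "g w \<in> (\<lambda>z. g (SOME w. P w z)) ` Z" by blast
  qed
  then show "finite (g ` L)" using Z finite_surj by blast
  show "card (g ` L) \<le> card Z" using surj_card_le[OF Z sub] .
qed

section \<open>Min-plus recursion over the last letters\<close>

context theta_automaton
begin

text \<open>The matrix \<open>M(q, p)\<close> of costs along \<open>v\<close>; the target comes
  first so that \<open>leap v\<close> has the shape of \<open>M\<close> in
  \<open>argmin_exchange\<close>. It is meaningful only if a path from \<open>p\<close> to
  \<open>q\<close> on \<open>v\<close> exists.\<close>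

definition leap :: "'a list \<Rightarrow> 's \<Rightarrow> 's \<Rightarrow> int" where
  "leap v q p = Min {c. \<exists>r. path p v q c r}"

lemma finite_leap: "finite {c. \<exists>r. path p v q c r}"
  by (rule finite_subset[OF _ finite_imageI[OF finite_paths[of p v], of "\<lambda>(q, c, r). c"]]) force

lemma leap_le: "path p v q c r \<Longrightarrow> leap v q p \<le> c"
  unfolding leap_def using finite_leap by (intro Min_le) auto

lemma leap_attained: "path p v q c r \<Longrightarrow> \<exists>r. path p v q (leap v q p) r"
  using Min_in[OF finite_leap[of p v q]] unfolding leap_def by blast

text \<open>Both products equal \<open>\<rho> (u @ v) / \<rho> u\<close>, because \<open>p\<close>
  and \<open>p'\<close> are reached on the same word \<open>u\<close>.\<close>

lemma same_factor:
  assumes "ipath u p c" "path p v q c1 r" "ipath u p' c'" "path p' v q' c2 r'"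
  shows "r = r'"
proof -
  have "int (\<rho> u) * r = int (\<rho> u) * r'"
    using ipath_append(2)[OF assms(1,2)] ipath_append(2)[OF assms(3,4)] by (rule trans[OF sym])
  moreover have "int (\<rho> u) \<noteq> 0" using \<rho>_pos[OF ipath_lists[OF assms(1)]] by simp
  ultimately show ?thesis by (metis mult_left_cancel)
qed

text \<open>Together with \<open>best_to_via_leap\<close> this presents
  \<open>best_to (u @ v)\<close> as the min-plus product of the matrix \<open>leap v\<close> and the
  vector \<open>r * best_to u\<close>, taken over the existing paths.\<close>

lemma best_to_le_leap:
  assumes "ipath u p c" "path p v q c' r"
  shows "best_to (u @ v) q \<le> leap v q p + r * best_to u p"
proof -
  obtain r' where r': "path p v q (leap v q p) r'" using leap_attained[OF assms(2)] by blast
  have "r' = r" using same_factor[OF assms(1) r' assms] .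
  then show ?thesis
    using best_to_le ipath_append(1)[OF best_to_attained[OF assms(1)] r'] by (metis add.commute)
qed

lemma best_to_via_leap:
  assumes "ipath (u @ v) q c"
  obtains p c1 c2 r where "ipath u p c1" "path p v q c2 r"
    "best_to (u @ v) q = leap v q p + r * best_to u p"
proof -
  obtain p c1 c2 r where *: "ipath u p c1" "path p v q c2 r" "best_to (u @ v) q = r * c1 + c2"
    using best_to_attained[OF assms] by (rule ipath_split)
  have "r * best_to u p \<le> r * c1"
    using best_to_le[OF *(1)] path_factor_pos[OF *(2)] by (intro mult_left_mono) auto
  then have "best_to (u @ v) q \<ge> leap v q p + r * best_to u p"
    using leap_le[OF *(2)] *(3) by linarith
  then show thesis using that[OF *(1,2)] best_to_le_leap[OF *(1,2)] by simp
qed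

text \<open>The data that determine the gaps after \<open>w = u @ v\<close>: modulo the discount product \<open>r\<close> of \<open>v\<close>, which
  \<open>p\<close> and \<open>v\<close> determine, the gaps depend only on a selection \<open>\<phi>\<close> of optimal intermediate states,
  and by \<open>argmin_exchange\<close> only on the fibre sizes of \<open>\<phi>\<close>.\<close>

definition signature :: "'a list \<Rightarrow> 'a list \<times> 's \<times> 's \<times> 's set \<times> 's multiset \<Rightarrow> bool" where
  "signature w = (\<lambda>(v, p, q0, R, \<mu>). \<exists>u \<phi> s c r.
     w = u @ v \<and> (\<exists>c. ipath u p c) \<and> path p v s c r \<and>
     gap w q0 = Some 0 \<and> R = {q. gap w q \<noteq> None} \<and> \<mu> = image_mset \<phi> (mset_set R) \<and>
     (\<forall>q\<in>R. (\<exists>c. ipath u (\<phi> q) c) \<and> (\<exists>c. path (\<phi> q) v q c r) \<and>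
        best_to w q = leap v q (\<phi> q) + r * best_to u (\<phi> q)))"

lemma finite_states: "finite (states A)"
  using nmda by (simp add: is_NMDA_def)

lemma gap_states: "gap u q \<noteq> None \<Longrightarrow> q \<in> states A"
  using gap_SomeD(1) ipath_states by blast

text \<open>By \<open>argmin_exchange\<close> both words can be evaluated with the selection
  \<open>\<phi>'\<close>. In differences against \<open>q0\<close> the \<open>leap\<close> terms
  agree and the rest are multiples of \<open>r\<close>, so the gaps are congruent modulo
  \<open>r\<close>. Being nonnegative and below \<open>4 * bnd \<le> r\<close>, they
  coincide.\<close>

lemma signature_unique:
  assumes "signature w (v, p, q0, R, \<mu>)" "signature w' (v, p, q0, R, \<mu>)" and v: "4 * bnd \<le> 2 ^ length v"
  shows "gap w = gap w'"
proof -
  obtain u \<phi> s c r where 1: "w = u @ v" "\<exists>c. ipath u p c" "path p v s c r"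
     "gap w q0 = Some 0" "R = {q. gap w q \<noteq> None}" "\<mu> = image_mset \<phi> (mset_set R)"
     "\<And>q. q \<in> R \<Longrightarrow> (\<exists>c. ipath u (\<phi> q) c) \<and> (\<exists>c. path (\<phi> q) v q c r) \<and>
        best_to w q = leap v q (\<phi> q) + r * best_to u (\<phi> q)"
    using assms(1) unfolding signature_def prod.case by blast
  obtain u' \<phi>' s' c' r' where 2: "w' = u' @ v" "\<exists>c. ipath u' p c" "path p v s' c' r'"
     "gap w' q0 = Some 0" "R = {q. gap w' q \<noteq> None}" "\<mu> = image_mset \<phi>' (mset_set R)"
     "\<And>q. q \<in> R \<Longrightarrow> (\<exists>c. ipath u' (\<phi>' q) c) \<and> (\<exists>c. path (\<phi>' q) v q c r') \<and>
        best_to w' q = leap v q (\<phi>' q) + r' * best_to u' (\<phi>' q)"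
    using assms(2) unfolding signature_def prod.case by blast
  \<comment> \<open>All paths on \<open>v\<close> from the reached state \<open>p\<close> have the
    same product, so \<open>p\<close> links the two words.\<close>
  have rr: "r' = r" using same_factor 1(2,3) 2(2,3) by blast
  have "R \<subseteq> states A" using gap_states unfolding 1(5) by blast
  then have R: "finite R" by (rule finite_subset[OF _ finite_states])
  have fibres: "image_mset \<phi> (mset_set R) = image_mset \<phi>' (mset_set R)" using 1(6) 2(6) by simp
  \<comment> \<open>Equal images make the states selected for one word reachable on the prefix of
    the other, so each selection competes with the other.\<close>
  have img: "\<phi> ` R = \<phi>' ` R" using R
    arg_cong[OF fibres, of set_mset] by simp
  have le1: "leap v q (\<phi> q) + r * best_to u (\<phi> q) \<le> leap v q (\<phi>' q) + r * best_to u (\<phi>' q)" if q: "q \<in> R" for q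
  proof -
    obtain q1 where "q1 \<in> R" "\<phi>' q = \<phi> q1" using img q by (metis imageE imageI)
    then obtain c1 where "ipath u (\<phi>' q) c1" using 1(7) by metis
    moreover obtain c2 where "path (\<phi>' q) v q c2 r" using 2(7)[OF q] rr by blast
    ultimately show ?thesis using best_to_le_leap 1(1) 1(7)[OF q] by metis
  qed
  have le2: "leap v q (\<phi>' q) + r * best_to u' (\<phi>' q) \<le> leap v q (\<phi> q) + r * best_to u' (\<phi> q)" if q: "q \<in> R" for q
  proof -
    obtain q1 where "q1 \<in> R" "\<phi> q = \<phi>' q1" using img q by (metis imageE imageI)
    then obtain c1 where "ipath u' (\<phi> q) c1" using 2(7) by metis
    moreover obtain c2 where "path (\<phi> q) v q c2 r" using 1(7)[OF q] rr by blast
    ultimately show ?thesis using best_to_le_leap 2(1) 2(7)[OF q] rr by metis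
  qed
  have w: "best_to w q = leap v q (\<phi>' q) + r * best_to u (\<phi>' q)" if q: "q \<in> R" for q
    using argmin_exchange[where M = "leap v" and x = "\<lambda>p. r * best_to u p" and y = "\<lambda>p. r * best_to u' p",
        OF R fibres le1 le2 q] 1(7)[OF q] by simp
  have w': "best_to w' q = leap v q (\<phi>' q) + r * best_to u' (\<phi>' q)" if q: "q \<in> R" for q
    using 2(7)[OF q] rr by simp
  \<comment> \<open>As \<open>q0\<close> has gap 0 in both words, it recovers \<open>best\<close>
    from \<open>best_to\<close>.\<close>
  have q0: "q0 \<in> R" "best w = best_to w q0" "best w' = best_to w' q0"
    using 1(4,5) gap_SomeD(4)[OF 1(4)] gap_SomeD(4)[OF 2(4)] by auto
  have r: "4 * bnd \<le> r" using path_factor[OF 1(3)] v by linarith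
  show ?thesis
  proof
    fix q
    show "gap w q = gap w' q"
    proof (cases "q \<in> R")
      case False
      then have "gap w q = None" "gap w' q = None" using 1(5) 2(5) by blast+
      then show ?thesis by simp
    next
      case True
      then obtain g g' where g: "gap w q = Some g" "gap w' q = Some g'" using 1(5) 2(5) by blast
      have "g = best_to w q - best_to w q0" "g' = best_to w' q - best_to w' q0"
        using gap_SomeD(4)[OF g(1)] gap_SomeD(4)[OF g(2)] q0 by auto
      then have "g - g' = r * (best_to u (\<phi>' q) - best_to u (\<phi>' q0) - best_to u' (\<phi>' q) + best_to u' (\<phi>' q0))"
        using w[OF True] w[OF q0(1)] w'[OF True] w'[OF q0(1)] by (simp add: algebra_simps)
      then have "r dvd g - g'" by simp
      moreover have "\<bar>g - g'\<bar> < r" using gap_SomeD(2,3)[OF g(1)] gap_SomeD(2,3)[OF g(2)] r by linarith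
      ultimately have "g - g' = 0" using dvd_imp_le_int[of "g - g'" r] by linarith
      then show ?thesis using g by simp
    qed
  qed
qed

text \<open>Here \<open>v\<close> is the suffix of length \<open>m\<close>, \<open>q0\<close> is an
  optimal final state, and the min-plus recursion supplies the selection on the states with a
  recorded gap.\<close>

lemma signature_exists:
  assumes w: "w \<in> lists S" "m \<le> length w"
  shows "\<exists>\<sigma> \<in> {v. set v \<subseteq> S \<and> length v = m} \<times> states A \<times> states A \<times>
      (SIGMA R:Pow (states A). {\<mu>. set_mset \<mu> \<subseteq> states A \<and> size \<mu> = card R}). signature w \<sigma>"
proof -
  define u v where "u = take (length w - m) w" and "v = drop (length w - m) w"
  have uv: "w = u @ v" "length v = m" using w(2) by (auto simp: u_def v_def)
  have uS: "u \<in> lists S" and vS: "v \<in> lists S" using w(1) uv by auto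
  obtain p c0 where p: "ipath u p c0" using ex_ipath[OF uS] by blast
  obtain s c r where s: "path p v s c r" using ex_path[OF ipath_states[OF p] vS] by blast
  obtain q0 where q0: "ipath w q0 (best w)" using best_attained[OF w(1)] by blast
  obtain g where "gap w q0 = Some g" "best w + g \<le> best w" using gap_SomeI[OF q0] bnd_pos by auto
  then have g0: "gap w q0 = Some 0" using gap_SomeD(2) by force
  define R where "R = {q. gap w q \<noteq> None}"
  have "\<exists>p'. (\<exists>c. ipath u p' c) \<and> (\<exists>c. path p' v q c r) \<and> best_to w q = leap v q p' + r * best_to u p'"
    if "q \<in> R" for q
  proof -
    obtain g where "gap w q = Some g" using \<open>q \<in> R\<close> by (auto simp: R_def)
    then have "ipath (u @ v) q (best w + g)" using gap_SomeD(1) uv(1) by blast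
    then obtain p' c1 c2 r' where *: "ipath u p' c1" "path p' v q c2 r'"
      "best_to (u @ v) q = leap v q p' + r' * best_to u p'" by (rule best_to_via_leap)
    moreover have "r' = r" using same_factor[OF *(1,2) p s] .
    ultimately show ?thesis using uv(1) by blast
  qed
  then obtain \<phi> where \<phi>: "\<forall>q\<in>R. (\<exists>c. ipath u (\<phi> q) c) \<and> (\<exists>c. path (\<phi> q) v q c r) \<and>
      best_to w q = leap v q (\<phi> q) + r * best_to u (\<phi> q)" by metis
  have Rs: "R \<subseteq> states A" using gap_states by (auto simp: R_def)
  have "finite R" using Rs finite_states finite_subset by blast
  moreover have "\<phi> ` R \<subseteq> states A" using \<phi> ipath_states by blast
  ultimately have \<mu>: "set_mset (image_mset \<phi> (mset_set R)) \<subseteq> states A" "size (image_mset \<phi> (mset_set R)) = card R" by auto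
  have "signature w (v, p, q0, R, image_mset \<phi> (mset_set R))"
    unfolding signature_def prod.case using uv(1) p s g0 R_def \<phi> by blast
  moreover have "set v \<subseteq> S" using vS by auto
  then have "(v, p, q0, R, image_mset \<phi> (mset_set R)) \<in> {v. set v \<subseteq> S \<and> length v = m} \<times> states A \<times> states A \<times>
      (SIGMA R:Pow (states A). {\<mu>. set_mset \<mu> \<subseteq> states A \<and> size \<mu> = card R})"
    unfolding mem_Sigma_iff mem_Collect_eq Pow_iff
    using uv(2) ipath_states[OF p] ipath_states[OF q0] Rs \<mu> by (intro conjI)
  ultimately show ?thesis by (rule bexI)
qed

text \<open>There are \<open>card S ^ m\<close> suffixes. With \<open>k\<close> states, each of
  \<open>p\<close>, \<open>q0\<close> and \<open>R\<close> contributes a factor of at most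
  \<open>2 ^ k\<close> and the multiset one of at most \<open>2 ^ (2 * k)\<close>, whence the
  exponent \<open>5 * k\<close>.\<close>

lemma card_gaps_long:
  assumes m: "4 * bnd \<le> 2 ^ m"
  shows "finite (gap ` {w \<in> lists S. m \<le> length w})"
    and "card (gap ` {w \<in> lists S. m \<le> length w}) \<le> card S ^ m * 2 ^ (5 * card (states A))"
proof -
  let ?k = "card (states A)"
  let ?M = "SIGMA R:Pow (states A). {\<mu>. set_mset \<mu> \<subseteq> states A \<and> size \<mu> = card R}"
  let ?Z = "{v. set v \<subseteq> S \<and> length v = m} \<times> states A \<times> states A \<times> ?M"
  have fS: "finite S" using nmda unfolding is_NMDA_def alphabet by blast
  have fM: "finite ?M" by (intro finite_SigmaI) (auto simp: finite_states multisets_of_size)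
  have Z: "finite ?Z" using finite_lists_length_eq[OF fS] finite_states fM by (intro finite_cartesian_product)
  \<comment> \<open>The suffix length is part of the predicate, because uniqueness has to hold for
    all classifiers and not just those in \<open>?Z\<close>.\<close>
  have unique: "gap w = gap w'"
    if "length (fst \<sigma>) = m \<and> signature w \<sigma>" "length (fst \<sigma>) = m \<and> signature w' \<sigma>" for w w' \<sigma>
  proof -
    obtain v p q0 R \<mu> where \<sigma>: "\<sigma> = (v, p, q0, R, \<mu>)" by (cases \<sigma>)
    have "signature w (v, p, q0, R, \<mu>)" "signature w' (v, p, q0, R, \<mu>)" "length v = m"
      using that by (simp_all add: \<sigma>)
    then show ?thesis using m by (intro signature_unique[of w v p q0 R \<mu> w']) simp_all
  qed
  have ex: "\<exists>\<sigma>\<in>?Z. length (fst \<sigma>) = m \<and> signature w \<sigma>" if "w \<in> {w \<in> lists S. m \<le> length w}" for w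
  proof -
    have "\<exists>\<sigma>\<in>?Z. signature w \<sigma>" by (rule signature_exists) (use that in auto)
    then obtain \<sigma> where \<sigma>: "\<sigma> \<in> ?Z" "signature w \<sigma>" by (rule bexE)
    have "length (fst \<sigma>) = m" using \<sigma>(1) unfolding mem_Times_iff mem_Collect_eq by (elim conjE)
    with \<sigma>(2) show ?thesis by (intro bexI[OF _ \<sigma>(1)] conjI)
  qed
  let ?P = "\<lambda>w \<sigma>. length (fst \<sigma>) = m \<and> signature w \<sigma>"
  show "finite (gap ` {w \<in> lists S. m \<le> length w})"
    by (rule card_image_le_classifier(1)[where P = ?P, OF Z]) (erule ex, erule (1) unique)
  have le: "card (gap ` {w \<in> lists S. m \<le> length w}) \<le> card ?Z"
    by (rule card_image_le_classifier(2)[where P = ?P, OF Z]) (erule ex, erule (1) unique)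
  have "card ?M = (\<Sum>R\<in>Pow (states A). card {\<mu>. set_mset \<mu> \<subseteq> states A \<and> size \<mu> = card R})"
    using finite_states by (intro card_SigmaI) (auto simp: multisets_of_size)
  also have "\<dots> \<le> (\<Sum>R\<in>Pow (states A). 2 ^ (2 * ?k))"
  proof (rule sum_mono)
    fix R assume "R \<in> Pow (states A)"
    then have "card R \<le> ?k" using finite_states by (auto intro: card_mono)
    then have "(2::nat) ^ (card R + ?k) \<le> 2 ^ (2 * ?k)" by (intro power_increasing) auto
    then show "card {\<mu>. set_mset \<mu> \<subseteq> states A \<and> size \<mu> = card R} \<le> 2 ^ (2 * ?k)"
      using multisets_of_size(2)[OF finite_states, of "card R"] by linarith
  qed
  also have "\<dots> = 2 ^ ?k * 2 ^ (2 * ?k)" using finite_states by (simp add: card_Pow)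
  finally have M: "card ?M \<le> 2 ^ ?k * 2 ^ (2 * ?k)" .
  have k: "?k \<le> 2 ^ ?k" using less_exp[of ?k] by simp
  have "card ?Z = card S ^ m * (?k * (?k * card ?M))"
    using card_lists_length_eq[OF fS] by (simp add: card_cartesian_product)
  also have "\<dots> \<le> card S ^ m * (2 ^ ?k * (2 ^ ?k * (2 ^ ?k * 2 ^ (2 * ?k))))"
    using M k by (intro mult_mono) auto
  also have "\<dots> = card S ^ m * 2 ^ (5 * ?k)" by (simp add: power_add[symmetric])
  finally show "card (gap ` {w \<in> lists S. m \<le> length w}) \<le> card S ^ m * 2 ^ (5 * ?k)"
    using le by linarith
qed

end

subsection \<open>Size bounds\<close>

text \<open>For \<open>w = p / k\<close> in lowest terms, \<open>k\<close> divides
  \<open>p * d\<close> and is coprime to \<open>p\<close>.\<close>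

lemma quotient_of_denominator_dvd:
  assumes "w * of_int d \<in> \<int>"
  shows "snd (quotient_of w) dvd d"
proof -
  obtain p k where pk: "quotient_of w = (p, k)" by (metis surj_pair)
  obtain z where z: "w * of_int d = of_int z" using assms by (auto elim: Ints_cases)
  have k: "k > 0" using quotient_of_denom_pos[OF pk] .
  have "of_int (p * d) = (of_int (z * k) :: rat)"
    using z k quotient_of_div[OF pk] by (simp add: field_simps)
  then have "p * d = z * k" by (simp only: of_int_eq_iff)
  then have "k dvd p * d" by simp
  then show ?thesis using quotient_of_coprime[OF pk] pk
    by (simp add: coprime_commute coprime_dvd_mult_right_iff)
qed

text \<open>The value \<open>2 ^ k\<close> itself takes \<open>k + 1\<close> binary digits, and the
  sign one more bit.\<close>

lemma int_length_le: "\<bar>z\<bar> \<le> 2 ^ k \<Longrightarrow> int_length z \<le> k + 2"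
proof -
  assume "\<bar>z\<bar> \<le> 2 ^ k"
  then have "\<bar>z\<bar> < 2 ^ (k + 1)" by (simp add: le_less_trans)
  then have "nat \<bar>z\<bar> < 2 ^ (k + 1)" by (simp add: nat_less_iff)
  then show ?thesis using floorlog_leI[of "nat \<bar>z\<bar>" 2 "k + 1"] by (simp add: int_length_def)
qed

lemma int_length_mono: "\<bar>x\<bar> \<le> \<bar>y\<bar> \<Longrightarrow> int_length x \<le> int_length y"
  unfolding int_length_def by (intro add_left_mono floorlog_mono nat_mono)

text \<open>By completeness every state and every letter occurs in a transition, so
  \<open>card (transitions A)\<close> bounds both counts.\<close>

lemma nmda_size_pos: "is_NMDA A \<Longrightarrow> nmda_size A > 0"
  and card_states_le_size: "is_NMDA A \<Longrightarrow> card (states A) \<le> nmda_size A"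
  and card_alphabet_le_size: "is_NMDA A \<Longrightarrow> card (alphabet A) \<le> nmda_size A"
proof -
  assume N: "is_NMDA A"
  note le = nmda_size_bounds(1)[OF N] and fin = finite_transitions[OF N]
  obtain q0 a0 where q0: "q0 \<in> states A" "a0 \<in> alphabet A" using N unfolding is_NMDA_def by blast
  have "states A \<subseteq> fst ` transitions A"
  proof
    fix q assume "q \<in> states A"
    then obtain q' where "(q, a0, q') \<in> transitions A" by (rule successor_exists[OF N _ q0(2)])
    then show "q \<in> fst ` transitions A" by (rule image_eqI[rotated]) simp
  qed
  from surj_card_le[OF fin this] have "card (states A) \<le> card (transitions A)" .
  then show "card (states A) \<le> nmda_size A" using le by simp
  have "alphabet A \<subseteq> (fst \<circ> snd) ` transitions A"
  proof
    fix a assume "a \<in> alphabet A"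
    then obtain q' where "(q0, a, q') \<in> transitions A" by (rule successor_exists[OF N q0(1)])
    then show "a \<in> (fst \<circ> snd) ` transitions A" by (rule image_eqI[rotated]) simp
  qed
  from surj_card_le[OF fin this] have "card (alphabet A) \<le> card (transitions A)" .
  then show 1: "card (alphabet A) \<le> nmda_size A" using le by simp
  have "card (alphabet A) > 0" unfolding card_gt_0_iff using N unfolding is_NMDA_def by blast
  then show "nmda_size A > 0" using 1 by simp
qed

lemma states_representableI:
  assumes "finite (states D)" "card (states D) \<le> 2 ^ b"
  shows "states_representable D b"
proof -
  let ?L = "{xs :: bool list. set xs \<subseteq> UNIV \<and> length xs = b}"
  have "finite ?L" "card ?L = 2 ^ b"
    using finite_lists_length_eq[of "UNIV :: bool set" b] card_lists_length_eq[of "UNIV :: bool set" b] by auto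
  then obtain f where "f ` states D \<subseteq> ?L" "inj_on f (states D)"
    using card_le_inj[OF assms(1), of ?L] assms(2) by auto
  then show ?thesis unfolding states_representable_def by (intro exI[of _ f]) auto
qed

section \<open>Number of residuals and size of the deterministic automaton\<close>

context theta_automaton
begin

lemma card_residuals:
  shows "finite (residual S \<theta> val ` lists S)"
    and "card (residual S \<theta> val ` lists S) \<le> card S ^ (nmda_size A + 2) * 2 ^ (5 * nmda_size A + 3)"
proof -
  let ?n = "nmda_size A" and ?s = "card S"
  \<comment> \<open>With this length \<open>2 ^ m = 4 * bnd\<close>, as
    \<open>card_gaps_long\<close> requires; words of length at most \<open>m\<close> are few enough
    to be counted individually.\<close>
  define m where "m = ?n + 2"
  have fS: "finite S" "S \<noteq> {}" using nmda unfolding is_NMDA_def alphabet by blast+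
  then have s: "?s \<ge> 1" using card_gt_0_iff[of S] by linarith
  let ?long = "{w \<in> lists S. m \<le> length w}" and ?short = "{w. set w \<subseteq> S \<and> length w \<le> m}"
  have fin_short: "finite ?short" using finite_lists_length_le[OF fS(1)] .
  have "card ?short = (\<Sum>i\<le>m. ?s ^ i)" by (rule card_lists_length_le[OF fS(1)])
  also have "\<dots> \<le> (\<Sum>i\<le>m. ?s ^ m)" using s by (intro sum_mono power_increasing) auto
  also have "\<dots> = Suc m * ?s ^ m" by simp
  also have "\<dots> \<le> 2 ^ m * ?s ^ m" using less_exp[of m] by (intro mult_right_mono) (auto simp: Suc_le_eq)
  finally have short: "card (gap ` ?short) \<le> 2 ^ m * ?s ^ m"
    using card_image_le[OF fin_short, of gap] by linarith
  have "4 * bnd \<le> 2 ^ m" by (simp add: bnd_def m_def)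
  note long = card_gaps_long[OF this]
  have "2 ^ (5 * card (states A)) \<le> (2::nat) ^ (5 * ?n)"
    using card_states_le_size[OF nmda] by (intro power_increasing) auto
  then have "?s ^ m * 2 ^ (5 * card (states A)) \<le> ?s ^ m * 2 ^ (5 * ?n)" by (rule mult_le_mono2)
  then have long': "card (gap ` ?long) \<le> 2 ^ (5 * ?n) * ?s ^ m"
    unfolding mult.commute[of "2 ^ (5 * ?n)"] using long(2) by (rule order_trans[rotated])
  have "lists S \<subseteq> ?short \<union> ?long" by auto
  then have sub: "gap ` lists S \<subseteq> gap ` ?short \<union> gap ` ?long" by auto
  have fin: "finite (gap ` lists S)" using finite_subset[OF sub] fin_short long(1) by simp
  have "card (gap ` lists S) \<le> card (gap ` ?short \<union> gap ` ?long)"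
    using fin_short long(1) by (intro card_mono[OF _ sub]) simp
  also have "\<dots> \<le> card (gap ` ?short) + card (gap ` ?long)" by (rule card_Un_le)
  also have "\<dots> \<le> (2 ^ m + 2 ^ (5 * ?n)) * ?s ^ m" using short long' by (simp add: add_mult_distrib)
  also have "\<dots> \<le> 2 ^ (5 * ?n + 3) * ?s ^ m"
  proof (rule mult_right_mono)
    have "(2::nat) ^ m \<le> 2 ^ (5 * ?n + 2)" "(2::nat) ^ (5 * ?n) \<le> 2 ^ (5 * ?n + 2)"
      by (rule power_increasing; simp add: m_def)+
    then show "2 ^ m + 2 ^ (5 * ?n) \<le> (2::nat) ^ (5 * ?n + 3)" by (simp add: power_add)
  qed simp
  finally have c: "card (gap ` lists S) \<le> ?s ^ (?n + 2) * 2 ^ (5 * ?n + 3)" by (simp add: m_def mult.commute)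
  let ?P = "\<lambda>w z. w \<in> lists S \<and> gap w = z"
  have *: "\<exists>z\<in>gap ` lists S. ?P w z" if "w \<in> lists S" for w using that by blast
  have **: "residual S \<theta> val w = residual S \<theta> val w'" if "?P w z" "?P w' z" for w w' z
    using that residual_eq_if_gap_eq by metis
  show "finite (residual S \<theta> val ` lists S)"
    by (rule card_image_le_classifier(1)[where P = ?P, OF fin]) (erule *, erule (1) **)
  have "card (residual S \<theta> val ` lists S) \<le> card (gap ` lists S)"
    by (rule card_image_le_classifier(2)[where P = ?P, OF fin]) (erule *, erule (1) **)
  then show "card (residual S \<theta> val ` lists S) \<le> ?s ^ (?n + 2) * 2 ^ (5 * ?n + 3)" using c by linarith
qed

lemma path_single:
  assumes "path p [a] q c r"
  shows "(p, a, q) \<in> transitions A" "r = dc (p, a, q)" "c = r * wt (p, a, q)"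
proof -
  have "path p ([] @ [a]) q c r" using assms by simp
  then obtain q' c' r' where *: "path p [] q' c' r'" "(q', a, q) \<in> transitions A"
    "c = dc (q', a, q) * (c' + wt (q', a, q))" "r = r' * dc (q', a, q)" by (rule path_snocE)
  then show "(p, a, q) \<in> transitions A" "r = dc (p, a, q)" "c = r * wt (p, a, q)"
    using path_NilE[OF *(1)] by auto
qed

text \<open>The discount factors of the quotient already occur in \<open>A\<close>, so their binary
  lengths do not grow.\<close>

lemma ex_discount_eq:
  assumes "u \<in> lists S" "a \<in> S"
  shows "\<exists>t\<in>transitions A. discount A t = of_nat (\<theta> (u @ [a]))"
proof -
  obtain p c where p: "ipath u p c" using ex_ipath[OF assms(1)] by blast
  have "[a] \<in> lists S" using assms by simp
  then obtain q c' r where q: "path p [a] q c' r" using ex_path[OF ipath_states[OF p]] by blast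
  note t = path_single[OF q]
  have "int (\<rho> u) * int (\<theta> (u @ [a])) = int (\<rho> u) * r"
    using ipath_append(2)[OF p q] by simp
  moreover have "int (\<rho> u) \<noteq> 0" using \<rho>_pos[OF assms(1)] by simp
  ultimately have "int (\<theta> (u @ [a])) = dc (p, a, q)" using t(2) by (metis mult_left_cancel)
  then have "discount A (p, a, q) = of_nat (\<theta> (u @ [a]))"
    using discount_eq[OF t(1)] by (metis of_int_of_nat_eq)
  then show ?thesis using t(1) by blast
qed

text \<open>An optimal run on \<open>u @ [a]\<close> enters its last transition at cost at least
  \<open>best u\<close>, and an optimal run on \<open>u\<close> can be continued by
  \<open>a\<close>; so the increment lies between two values of \<open>wt\<close>.\<close>

lemma residual_weight:
  assumes "u \<in> lists S" "a \<in> S"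
  shows "\<exists>j. \<bar>j\<bar> \<le> bnd \<and> of_nat (\<rho> u) * (val (u @ [a]) - val u) = of_int j / of_int den"
proof -
  have ua: "u @ [a] \<in> lists S" "[a] \<in> lists S" using assms by auto
  obtain s where s: "ipath (u @ [a]) s (best (u @ [a]))" using best_attained[OF ua(1)] by blast
  obtain q c1 c2 r where 1: "ipath u q c1" "path q [a] s c2 r" "best (u @ [a]) = r * c1 + c2"
    "int (\<rho> (u @ [a])) = int (\<rho> u) * r" using s by (rule ipath_split)
  obtain p where p: "ipath u p (best u)" using best_attained[OF assms(1)] by blast
  obtain s' c' r' where 2: "path p [a] s' c' r'" using ex_path[OF ipath_states[OF p] ua(2)] by blast
  have "r' = r" using same_factor[OF p 2 1(1,2)] .
  \<comment> \<open>The scaling of \<open>best (u @ [a])\<close> includes the factor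
    \<open>r\<close> of the last letter; \<open>j\<close> is the increment with this factor
    removed.\<close>
  define j where "j = c1 + wt (q, a, s) - best u"
  have b: "best (u @ [a]) = r * (best u + j)"
    using 1(3) path_single[OF 1(2)] by (simp add: j_def algebra_simps)
  have r: "r \<ge> 1" using path_factor_pos[OF 1(2)] .
  have "best (u @ [a]) \<le> r * (best u + wt (p, a, s'))"
    using best_le[OF ipath_append(1)[OF p 2]] path_single[OF 2] \<open>r' = r\<close> by (simp add: algebra_simps)
  then have "j \<le> wt (p, a, s')" using b r by simp
  moreover have "j \<ge> wt (q, a, s)" using best_le[OF 1(1)] by (simp add: j_def)
  ultimately have "\<bar>j\<bar> \<le> bnd"
    using wt_bound path_single(1)[OF 2] path_single(1)[OF 1(2)] by (smt (verit))
  moreover have "of_nat (\<rho> u) * (val (u @ [a]) - val u) = of_int j / of_int den"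
  proof -
    have e: "(of_nat (\<rho> (u @ [a])) :: rat) = of_nat (\<rho> u) * of_int r"
      by (metis 1(4) of_int_mult of_int_of_nat_eq)
    have "(of_nat (\<rho> u) :: rat) \<noteq> 0" using \<rho>_pos[OF assms(1)] by simp
    then show ?thesis using r den_pos unfolding val_def e b by (simp add: field_simps)
  qed
  ultimately show ?thesis by blast
qed

text \<open>Every weight of \<open>D\<close> is a fraction over \<open>den\<close>, so
  \<open>common_denominator D\<close> divides \<open>den\<close>, and passing to it does not enlarge
  numerators. With \<open>n = nmda_size A\<close>, a numerator takes at most \<open>n + 2\<close>
  bits and the denominator at most \<open>n\<close>.\<close>

lemma size_le:
  fixes D :: "('a, 't) nmda"
  assumes D: "is_NMDA D"
    and t: "\<And>t. t \<in> transitions D \<Longrightarrow> \<exists>u\<in>lists S. \<exists>a\<in>S.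
           weight D t = of_nat (\<rho> u) * (val (u @ [a]) - val u) \<and> discount D t = of_nat (\<theta> (u @ [a]))"
  shows "nmda_size D \<le> max (card (transitions D)) (2 * nmda_size A + 2)"
proof -
  let ?n = "nmda_size A"
  have j: "\<exists>j. \<bar>j\<bar> \<le> bnd \<and> weight D t = of_int j / of_int den" if "t \<in> transitions D" for t
    using t[OF that] residual_weight by metis
  have cd_pos: "common_denominator D > 0" using common_denominator_pos[OF finite_transitions[OF D]] .
  have "common_denominator D dvd den"
    unfolding common_denominator_def
  proof (rule Lcm_least)
    fix k assume "k \<in> (\<lambda>t. snd (quotient_of (weight D t))) ` transitions D"
    then obtain t where t: "t \<in> transitions D" "k = snd (quotient_of (weight D t))" by blast
    obtain j where "weight D t = of_int j / of_int den" using j[OF t(1)] by blast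
    then have "weight D t * of_int den = of_int j" using den_pos by simp
    then show "k dvd den" unfolding t(2) by (intro quotient_of_denominator_dvd) simp
  qed
  then have cd_le: "common_denominator D \<le> den" using den_pos by (simp add: zdvd_imp_le)
  \<comment> \<open>The size of \<open>A\<close> bounds the length of \<open>den\<close> through the
    \<open>weight_length\<close> of a transition, so one has to exist.\<close>
  obtain t0 where t0: "t0 \<in> transitions A" using nmda_size_pos[OF nmda] nmda successor_exists
    unfolding is_NMDA_def by (metis all_not_in_conv subsetD)
  have "int_length den \<le> ?n"
    using nmda_size_bounds(2)[OF nmda t0] by (simp add: weight_length_def den_def)
  then have cd_len: "int_length (common_denominator D) \<le> ?n"
    using int_length_mono[of "common_denominator D" den] cd_le cd_pos by simp
  have "weight_length D t \<le> 2 * ?n + 2" if tD: "t \<in> transitions D" for t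
  proof -
    obtain j where j: "\<bar>j\<bar> \<le> bnd" "weight D t = of_int j / of_int den" using j[OF tD] by blast
    obtain z where z: "weight D t * of_int (common_denominator D) = of_int z"
      using weight_times_common_denominator[OF tD] by (auto elim: Ints_cases)
    then have "of_int (z * den) = (of_int (j * common_denominator D) :: rat)"
      using j(2) den_pos by (simp add: field_simps)
    then have "z * den = j * common_denominator D" by (simp only: of_int_eq_iff)
    then have "\<bar>z\<bar> * den = \<bar>j\<bar> * common_denominator D"
      using den_pos cd_pos by (metis abs_mult abs_of_pos)
    also have "\<dots> \<le> \<bar>j\<bar> * den" using cd_le by (intro mult_left_mono) auto
    finally have "\<bar>z\<bar> \<le> \<bar>j\<bar>" using den_pos by simp
    then have "\<bar>z\<bar> \<le> 2 ^ ?n" using j(1) by (simp add: bnd_def)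
    then have "int_length z \<le> ?n + 2" by (rule int_length_le)
    then show ?thesis using cd_len z by (simp add: weight_length_def)
  qed
  moreover have "discount_length D t \<le> 2 * ?n + 2" if tD: "t \<in> transitions D" for t
  proof -
    obtain t' where "t' \<in> transitions A" "discount A t' = discount D t" using t[OF tD] ex_discount_eq by metis
    then show ?thesis using nmda_size_bounds(3)[OF nmda, of t'] by (simp add: discount_length_def)
  qed
  ultimately show ?thesis
    unfolding nmda_size_def[of D] using finite_transitions[OF D]
    by (subst Max_le_iff) (auto simp: le_max_iff_disj intro: order_trans)
qed

lemma determinization:
  obtains D :: "('a, nat) nmda"
  where "theta_DMDA S \<theta> D" "equivalent_fin D A" "equivalent_inf D A"
    "card (states D) \<le> card S ^ (nmda_size A + 2) * 2 ^ (5 * nmda_size A + 3)"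
    "nmda_size D \<le> max (card (states D) * card S) (2 * nmda_size A + 2)"
proof -
  have fS: "finite S" "S \<noteq> {}" using nmda unfolding is_NMDA_def alphabet by blast+
  have "ipath [] q c \<Longrightarrow> c = 0" for q c using path_NilE by (auto simp: ipath_def)
  then have "best [] = 0" using best_attained[of "[]"] by auto
  then have v0: "val [] = 0" by (simp add: val_def)
  obtain D :: "('a, nat) nmda" where D: "theta_DMDA S \<theta> D"
    "\<And>w. w \<in> lists S \<Longrightarrow> fin_value D w = of_rat (val w)"
    "card (states D) = card (residual S \<theta> val ` lists S)"
    "card (transitions D) = card (states D) * card S"
    "\<And>t. t \<in> transitions D \<Longrightarrow> \<exists>u\<in>lists S. \<exists>a\<in>S.
           weight D t = of_nat (\<rho> u) * (val (u @ [a]) - val u) \<and> discount D t = of_nat (\<theta> (u @ [a]))"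
    using residual_automaton[OF fS choice v0 card_residuals(1)] by metis
  have aD: "alphabet D = S" and iD: "integral_NMDA D" and nD: "is_NMDA D"
    using D(1) by (auto simp: theta_DMDA_def theta_NMDA_def integral_NMDA_def)
  have "equivalent_fin D A" using D(2) fin_value_eq by (simp add: equivalent_fin_def aD alphabet)
  moreover from equivalent_inf_if_equivalent_fin[OF iD integral this] have "equivalent_inf D A" .
  ultimately show thesis
    using that[OF D(1)] D(3,4) card_residuals(2) size_le[OF nD D(5)] by simp
qed

end

theorem theorem4p6:
  "\<exists>P :: nat poly. \<forall>S :: 'a set. finite S \<and> S \<noteq> {} \<longrightarrow>
     (\<exists>C :: nat. \<forall>\<theta>. choice_function S \<theta> \<longrightarrow>
        (\<forall>A :: ('a, 's) nmda. theta_NMDA S \<theta> A \<longrightarrow>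
           (\<exists>D :: ('a, nat) nmda.
              theta_DMDA S \<theta> D \<and>
              equivalent_fin D A \<and> equivalent_inf D A \<and>
              nmda_size D \<le> 2 ^ (C * nmda_size A) \<and>
              states_representable D (poly P (nmda_size A)))))"
\<comment> \<open>With \<open>n\<close> the size of \<open>A\<close>, the exponent of
  \<open>(2 ^ n) ^ (n + 2) * 2 ^ (5 * n + 3)\<close> is \<open>n * n + 7 * n + 3\<close>. Bounding
  \<open>card S\<close> by \<open>2 ^ n\<close>, via \<open>card S \<le> n\<close>, makes the
  polynomial independent of the alphabet.\<close>
proof (intro exI[of _ "[:3, 7, 1:]"] allI impI)
  fix S :: "'a set" assume S: "finite S \<and> S \<noteq> {}"
  let ?s = "card S"
  show "\<exists>C. \<forall>\<theta>. choice_function S \<theta> \<longrightarrow>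
        (\<forall>A :: ('a, 's) nmda. theta_NMDA S \<theta> A \<longrightarrow>
           (\<exists>D :: ('a, nat) nmda.
              theta_DMDA S \<theta> D \<and>
              equivalent_fin D A \<and> equivalent_inf D A \<and>
              nmda_size D \<le> 2 ^ (C * nmda_size A) \<and>
              states_representable D (poly [:3, 7, 1:] (nmda_size A))))"
  \<comment> \<open>With \<open>s = card S\<close> and \<open>s \<le> 2 ^ s\<close> there are at
    most \<open>2 ^ (s * (n + 3) + 5 * n + 3)\<close> transitions; for \<open>n \<ge> 1\<close> this
    exponent is at most \<open>(4 * s + 8) * n\<close>.\<close>
  proof (intro exI[of _ "4 * ?s + 8"] allI impI)
    fix \<theta> and A :: "('a, 's) nmda"
    assume th: "theta_NMDA S \<theta> A"
    interpret theta_automaton S \<theta> A using th by unfold_locales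
    let ?n = "nmda_size A"
    obtain D :: "('a, nat) nmda" where D: "theta_DMDA S \<theta> D" "equivalent_fin D A" "equivalent_inf D A"
      "card (states D) \<le> ?s ^ (?n + 2) * 2 ^ (5 * ?n + 3)"
      "nmda_size D \<le> max (card (states D) * ?s) (2 * ?n + 2)" by (rule determinization)
    have n: "?n \<ge> 1" using nmda_size_pos[OF nmda] by simp
    have "?s \<le> ?n" using card_alphabet_le_size[OF nmda] alphabet by simp
    then have "?s \<le> 2 ^ ?n" using less_exp[of ?n] by linarith
    then have "?s ^ (?n + 2) \<le> (2 ^ ?n) ^ (?n + 2)" by (rule power_mono) simp
    then have "card (states D) \<le> (2 ^ ?n) ^ (?n + 2) * 2 ^ (5 * ?n + 3)"
      using D(4) by (meson mult_le_mono1 order_trans)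
    also have "\<dots> = 2 ^ poly [:3, 7, 1:] ?n"
      by (simp add: power_mult[symmetric] power_add[symmetric] algebra_simps)
    finally have "states_representable D (poly [:3, 7, 1:] ?n)"
      using D(1) by (intro states_representableI) (auto simp: theta_DMDA_def is_DMDA_def is_NMDA_def)
    moreover have "nmda_size D \<le> 2 ^ ((4 * ?s + 8) * ?n)"
    proof -
      have "?s ^ (?n + 3) \<le> (2 ^ ?s) ^ (?n + 3)" using less_exp[of ?s] by (intro power_mono) auto
      then have "?s ^ (?n + 3) * 2 ^ (5 * ?n + 3) \<le> (2 ^ ?s) ^ (?n + 3) * 2 ^ (5 * ?n + 3)" by simp
      also have "\<dots> = 2 ^ (?s * (?n + 3) + (5 * ?n + 3))" by (simp only: power_mult power_add)
      also have "\<dots> \<le> 2 ^ ((4 * ?s + 8) * ?n)"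
      proof (rule power_increasing)
        have "?s * (?n + 3) + (5 * ?n + 3) \<le> ?s * (4 * ?n) + 8 * ?n"
          using n by (intro add_mono mult_left_mono) auto
        then show "?s * (?n + 3) + (5 * ?n + 3) \<le> (4 * ?s + 8) * ?n" by (simp add: algebra_simps)
      qed simp
      finally have a: "?s ^ (?n + 3) * 2 ^ (5 * ?n + 3) \<le> 2 ^ ((4 * ?s + 8) * ?n)" .
      have "card (states D) * ?s \<le> ?s ^ (?n + 2) * 2 ^ (5 * ?n + 3) * ?s" using D(4) by (rule mult_le_mono1)
      also have "\<dots> = ?s ^ (?n + 3) * 2 ^ (5 * ?n + 3)" by (simp add: eval_nat_numeral)
      finally have b: "card (states D) * ?s \<le> 2 ^ ((4 * ?s + 8) * ?n)" using a by linarith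
      have "2 * ?n + 2 \<le> (4 * ?s + 8) * ?n" using n by (simp add: algebra_simps)
      then have "2 * ?n + 2 \<le> 2 ^ ((4 * ?s + 8) * ?n)"
        using less_exp[of "(4 * ?s + 8) * ?n"] by linarith
      then show ?thesis using b D(5) by linarith
    qed
    ultimately show "\<exists>D :: ('a, nat) nmda.
              theta_DMDA S \<theta> D \<and>
              equivalent_fin D A \<and> equivalent_inf D A \<and>
              nmda_size D \<le> 2 ^ ((4 * ?s + 8) * ?n) \<and>
              states_representable D (poly [:3, 7, 1:] ?n)"
      using D(1-3) by blast
  qed
qed

end
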